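(* Let $n\ge 2$ and let $A_1\xrightarrow{\alpha_1}A_2\xrightarrow{\alpha_2}\cdots\xrightarrow{\alpha_{n-1}}A_n\xrightarrow{\alpha_n}A_{n+1}$ be an exact sequence of C*-algebras and C*-morphisms. For $1\le j\le n$ let $T_j$ be the NC mapping cylindrical telescope of the first $j$ morphisms $\alpha_1,\dots,\alpha_j$. Then $T_n\simeq T_{n-1}\oplus CA_{n+1}$, and in particular $$T_n\simeq \mathrm{Cyl}(\alpha_1)\oplus\Big(\bigoplus_{i=3}^{n+1}CA_i\Big).$$
   Context: C*-morphisms are $*$-homomorphisms; $\simeq$ is isomorphism of C*-algebras. $\mathbb{I}=[0,1]$, $\mathbb{I}A=C([0,1]\to A)$, and the NC cone over $A$ is $CA=\{f\in\mathbb{I}A : f(0)=0\}$. The NC mapping cylinder of $\alpha:A\to B$ is $\mathrm{Cyl}(\alpha)=\{a\oplus f\in A\oplus\mathbb{I}B : f(1)=\alpha(a)\}$. The NC mapping cylindrical telescope of $A_1\xrightarrow{\alpha_1}\cdots\xrightarrow{\alpha_j}A_{j+1}$ is the C*-algebra $$T_j=\{a\oplus f_2\oplus\dots\oplus f_{j+1}\in A_1\oplus\mathbb{I}A_2\oplus\dots\oplus\mathbb{I}A_{j+1} : f_{k+1}(1)=\alpha_k\circ\alpha_{k-1}\circ\dots\circ\alpha_1(a),\ k=1,\dots,j\},$$ so $T_1=\mathrm{Cyl}(\alpha_1)$. Exactness means $\ker\alpha_{k+1}=\operatorname{im}\alpha_k$ for $1\le k\le n-1$. *)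

theory Defs
  imports "HOL-Analysis.Analysis" "HOL-Algebra.Module" "HOL-Algebra.AbelCoset"
begin

text \<open>C*-algebras are carrier-based, so that a family indexed by a natural number can consist of
  different algebras. The field \<open>one\<close>, inherited from the ring record via \<open>module\<close>, is never
  constrained and morphisms need not respect it: algebras are not assumed to be unital.\<close>

record 'a cstar = "(complex, 'a) module" +
  adj :: "'a \<Rightarrow> 'a"
  nrm :: "'a \<Rightarrow> real"

definition complex_ring :: "complex ring" where
  "complex_ring = \<lparr>carrier = UNIV, monoid.mult = (*), one = 1, ring.zero = 0, add = (+)\<rparr>"

text \<open>The value \<open>0\<close> off the carrier is there because the locale \<open>Metric_space\<close> wants
  nonnegativity and symmetry on the whole type.\<close>

definition cstar_dist :: "'a cstar \<Rightarrow> 'a \<Rightarrow> 'a \<Rightarrow> real" where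
  "cstar_dist A x y =
     (if x \<in> carrier A \<and> y \<in> carrier A then nrm A (x \<ominus>\<^bsub>A\<^esub> y) else 0)"

definition cstar_topology :: "'a cstar \<Rightarrow> 'a topology" where
  "cstar_topology A = Metric_space.mtopology (carrier A) (cstar_dist A)"

locale cstar_algebra = module complex_ring A for A :: "'a cstar" (structure) +
  assumes mult_closed: "\<lbrakk>x \<in> carrier A; y \<in> carrier A\<rbrakk> \<Longrightarrow> x \<otimes> y \<in> carrier A"
    and mult_assoc: "\<lbrakk>x \<in> carrier A; y \<in> carrier A; z \<in> carrier A\<rbrakk>
      \<Longrightarrow> (x \<otimes> y) \<otimes> z = x \<otimes> (y \<otimes> z)"
    and mult_l_distr: "\<lbrakk>x \<in> carrier A; y \<in> carrier A; z \<in> carrier A\<rbrakk>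
      \<Longrightarrow> (x \<oplus> y) \<otimes> z = x \<otimes> z \<oplus> y \<otimes> z"
    and mult_r_distr: "\<lbrakk>x \<in> carrier A; y \<in> carrier A; z \<in> carrier A\<rbrakk>
      \<Longrightarrow> z \<otimes> (x \<oplus> y) = z \<otimes> x \<oplus> z \<otimes> y"
    and smult_mult_left: "\<lbrakk>x \<in> carrier A; y \<in> carrier A\<rbrakk>
      \<Longrightarrow> (c \<odot> x) \<otimes> y = c \<odot> (x \<otimes> y)"
    and smult_mult_right: "\<lbrakk>x \<in> carrier A; y \<in> carrier A\<rbrakk>
      \<Longrightarrow> x \<otimes> (c \<odot> y) = c \<odot> (x \<otimes> y)"
    and adj_closed: "x \<in> carrier A \<Longrightarrow> adj A x \<in> carrier A"
    and adj_adj: "x \<in> carrier A \<Longrightarrow> adj A (adj A x) = x"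
    and adj_add: "\<lbrakk>x \<in> carrier A; y \<in> carrier A\<rbrakk>
      \<Longrightarrow> adj A (x \<oplus> y) = adj A x \<oplus> adj A y"
    and adj_smult: "x \<in> carrier A \<Longrightarrow> adj A (c \<odot> x) = cnj c \<odot> adj A x"
    and adj_mult: "\<lbrakk>x \<in> carrier A; y \<in> carrier A\<rbrakk>
      \<Longrightarrow> adj A (x \<otimes> y) = adj A y \<otimes> adj A x"
    and nrm_nonneg: "x \<in> carrier A \<Longrightarrow> 0 \<le> nrm A x"
    and nrm_eq_0_iff: "x \<in> carrier A \<Longrightarrow> nrm A x = 0 \<longleftrightarrow> x = \<zero>"
    and nrm_triangle: "\<lbrakk>x \<in> carrier A; y \<in> carrier A\<rbrakk>
      \<Longrightarrow> nrm A (x \<oplus> y) \<le> nrm A x + nrm A y"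
    and nrm_smult: "x \<in> carrier A \<Longrightarrow> nrm A (c \<odot> x) = cmod c * nrm A x"
    and nrm_mult: "\<lbrakk>x \<in> carrier A; y \<in> carrier A\<rbrakk>
      \<Longrightarrow> nrm A (x \<otimes> y) \<le> nrm A x * nrm A y"
    and nrm_cstar: "x \<in> carrier A \<Longrightarrow> nrm A (adj A x \<otimes> x) = (nrm A x)\<^sup>2"
    and complete: "Metric_space.mcomplete (carrier A) (cstar_dist A)"

locale cstar_hom = A: cstar_algebra A + B: cstar_algebra B
  for A :: "'a cstar" and B :: "'b cstar" and h :: "'a \<Rightarrow> 'b" +
  assumes hom_closed: "x \<in> carrier A \<Longrightarrow> h x \<in> carrier B"
    and hom_add: "\<lbrakk>x \<in> carrier A; y \<in> carrier A\<rbrakk>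
      \<Longrightarrow> h (x \<oplus>\<^bsub>A\<^esub> y) = h x \<oplus>\<^bsub>B\<^esub> h y"
    and hom_smult: "x \<in> carrier A \<Longrightarrow> h (c \<odot>\<^bsub>A\<^esub> x) = c \<odot>\<^bsub>B\<^esub> h x"
    and hom_mult: "\<lbrakk>x \<in> carrier A; y \<in> carrier A\<rbrakk>
      \<Longrightarrow> h (x \<otimes>\<^bsub>A\<^esub> y) = h x \<otimes>\<^bsub>B\<^esub> h y"
    and hom_adj: "x \<in> carrier A \<Longrightarrow> h (adj A x) = adj B (h x)"

text \<open>By the definition of \<open>cstar_hom\<close>, the two isomorphic structures are C*-algebras.\<close>

definition cstar_isomorphic :: "'a cstar \<Rightarrow> 'b cstar \<Rightarrow> bool" (infix \<open>\<simeq>\<^sub>C\<close> 50) where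
  "A \<simeq>\<^sub>C B \<longleftrightarrow> (\<exists>h. cstar_hom A B h \<and> bij_betw h (carrier A) (carrier B))"

definition cstar_sum :: "'a cstar \<Rightarrow> 'b cstar \<Rightarrow> ('a \<times> 'b) cstar" (infixr \<open>\<oplus>\<^sub>C\<close> 65) where
  "A \<oplus>\<^sub>C B =
     \<lparr>carrier = carrier A \<times> carrier B,
      monoid.mult = (\<lambda>(a, b) (a', b'). (a \<otimes>\<^bsub>A\<^esub> a', b \<otimes>\<^bsub>B\<^esub> b')),
      one = (\<one>\<^bsub>A\<^esub>, \<one>\<^bsub>B\<^esub>),
      ring.zero = (\<zero>\<^bsub>A\<^esub>, \<zero>\<^bsub>B\<^esub>),
      add = (\<lambda>(a, b) (a', b'). (a \<oplus>\<^bsub>A\<^esub> a', b \<oplus>\<^bsub>B\<^esub> b')),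
      smult = (\<lambda>c (a, b). (c \<odot>\<^bsub>A\<^esub> a, c \<odot>\<^bsub>B\<^esub> b)),
      adj = (\<lambda>(a, b). (adj A a, adj B b)),
      nrm = (\<lambda>(a, b). max (nrm A a) (nrm B b))\<rparr>"

text \<open>The direct sum of a finite family. Norms being nonnegative, the extra \<open>0\<close> only matters
  for \<open>I = {}\<close>.\<close>

definition cstar_Sum :: "'i set \<Rightarrow> ('i \<Rightarrow> 'a cstar) \<Rightarrow> ('i \<Rightarrow> 'a) cstar" where
  "cstar_Sum I A =
     \<lparr>carrier = (\<Pi>\<^sub>E i\<in>I. carrier (A i)),
      monoid.mult = (\<lambda>x y. \<lambda>i\<in>I. x i \<otimes>\<^bsub>A i\<^esub> y i),
      one = (\<lambda>i\<in>I. \<one>\<^bsub>A i\<^esub>),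
      ring.zero = (\<lambda>i\<in>I. \<zero>\<^bsub>A i\<^esub>),
      add = (\<lambda>x y. \<lambda>i\<in>I. x i \<oplus>\<^bsub>A i\<^esub> y i),
      smult = (\<lambda>c x. \<lambda>i\<in>I. c \<odot>\<^bsub>A i\<^esub> x i),
      adj = (\<lambda>x. \<lambda>i\<in>I. adj (A i) (x i)),
      nrm = (\<lambda>x. Max (insert 0 ((\<lambda>i. nrm (A i) (x i)) ` I)))\<rparr>"

text \<open>The algebra of norm-continuous functions on the unit interval; elements are functions on
  the reals with the value \<open>undefined\<close> outside the interval.\<close>

definition path_algebra :: "'a cstar \<Rightarrow> (real \<Rightarrow> 'a) cstar" where
  "path_algebra A =
     \<lparr>carrier = {f \<in> extensional {0..1}.
        continuous_map (top_of_set {0..1}) (cstar_topology A) f},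
      monoid.mult = (\<lambda>f g. \<lambda>t\<in>{0..1}. f t \<otimes>\<^bsub>A\<^esub> g t),
      one = (\<lambda>t\<in>{0..1}. \<one>\<^bsub>A\<^esub>),
      ring.zero = (\<lambda>t\<in>{0..1}. \<zero>\<^bsub>A\<^esub>),
      add = (\<lambda>f g. \<lambda>t\<in>{0..1}. f t \<oplus>\<^bsub>A\<^esub> g t),
      smult = (\<lambda>c f. \<lambda>t\<in>{0..1}. c \<odot>\<^bsub>A\<^esub> f t),
      adj = (\<lambda>f. \<lambda>t\<in>{0..1}. adj A (f t)),
      nrm = (\<lambda>f. SUP t\<in>{0..1}. nrm A (f t))\<rparr>"

definition cstar_cone :: "'a cstar \<Rightarrow> (real \<Rightarrow> 'a) cstar" where
  "cstar_cone A = (path_algebra A)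
     \<lparr>carrier := {f \<in> carrier (path_algebra A). f 0 = \<zero>\<^bsub>A\<^esub>}\<rparr>"

definition Cyl :: "'a cstar \<Rightarrow> 'b cstar \<Rightarrow> ('a \<Rightarrow> 'b) \<Rightarrow> ('a \<times> (real \<Rightarrow> 'b)) cstar" where
  "Cyl A B \<alpha> = (A \<oplus>\<^sub>C path_algebra B)
     \<lparr>carrier := {(a, f) \<in> carrier (A \<oplus>\<^sub>C path_algebra B). f 1 = \<alpha> a}\<rparr>"

text \<open>\<open>iter_comp \<alpha> k\<close> is the composite of \<open>\<alpha> 1\<close>, ..., \<open>\<alpha> k\<close>, with \<open>\<alpha> 1\<close> applied first.\<close>

primrec iter_comp :: "(nat \<Rightarrow> 'a \<Rightarrow> 'a) \<Rightarrow> nat \<Rightarrow> 'a \<Rightarrow> 'a" where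
  "iter_comp \<alpha> 0 = id"
| "iter_comp \<alpha> (Suc k) = \<alpha> (Suc k) \<circ> iter_comp \<alpha> k"

definition telescope ::
  "(nat \<Rightarrow> 'a cstar) \<Rightarrow> (nat \<Rightarrow> 'a \<Rightarrow> 'a) \<Rightarrow> nat \<Rightarrow> ('a \<times> (nat \<Rightarrow> real \<Rightarrow> 'a)) cstar" where
  "telescope A \<alpha> j = (A 1 \<oplus>\<^sub>C cstar_Sum {2..j+1} (\<lambda>i. path_algebra (A i)))
     \<lparr>carrier := {(a, f) \<in> carrier (A 1 \<oplus>\<^sub>C cstar_Sum {2..j+1} (\<lambda>i. path_algebra (A i))).
        \<forall>k\<in>{1..j}. f (k+1) 1 = iter_comp \<alpha> k a}\<rparr>"

end

theory Submission
  imports Defs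
begin

text \<open>Exactness makes the composite of two consecutive morphisms vanish. So among the conditions
  \<open>f\<^bsub>k+1\<^esub>(1) = (\<alpha>\<^sub>k \<circ> \<dots> \<circ> \<alpha>\<^sub>1)(a)\<close> that define a telescope only the first one involves \<open>a\<close>; all others
  read \<open>f\<^bsub>k+1\<^esub>(1) = 0\<close> (\<open>carrier_telescope\<close>). A path that ends at zero and is otherwise unconstrained is,
  after reversal of time, an element of the cone. Reversing the last path, or all paths but the
  first, therefore gives the two isomorphisms (\<open>telescope_Suc_isomorphic\<close> and
  \<open>telescope_isomorphic_Cyl_cones\<close>).

  An isomorphism relates C*-algebras, so it also has to be shown that telescopes, cones, cylinders and
  sums are C*-algebras. The delicate point is completeness. Path algebras and finite direct sums are
  closed subalgebras of \<open>\<ell>\<^sup>\<infinity>\<close>-products (\<open>cstar_algebra_bounded_product\<close>), and cones, cylinders and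
  telescopes are equalizers of morphisms in such algebras (\<open>cstar_algebra_equalizer\<close>). Equalizers are
  closed because morphisms of C*-algebras are contractive (\<open>contractive\<close>).

  Contractivity is proved without spectral theory. For self-adjoint \<open>x\<close> with \<open>\<parallel>x\<parallel> < 1\<close>, the fixed point
  theorem yields \<open>v\<close>, formally \<open>1 - sqrt (1 - x\<^sup>2)\<close>, with \<open>2 v = x\<^sup>2 + v\<^sup>2\<close>. A morphism \<open>h\<close> preserves this
  equation, and it says that \<open>h x + i (1 - h v)\<close> is unitary in the unitisation of the target. The
  real part \<open>h x\<close> of a unitary has norm at most \<open>1\<close>.\<close>

section \<open>An introduction rule for C*-algebras\<close>

lemma carrier_complex_ring [simp]: "carrier complex_ring = UNIV"
  by (simp add: complex_ring_def)

lemma complex_ring_ops [simp]: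
  "\<one>\<^bsub>complex_ring\<^esub> = 1" "\<zero>\<^bsub>complex_ring\<^esub> = 0"
  "x \<otimes>\<^bsub>complex_ring\<^esub> y = x * y" "x \<oplus>\<^bsub>complex_ring\<^esub> y = x + y"
  by (simp_all add: complex_ring_def)

lemma cring_complex_ring: "cring complex_ring"
proof (rule cringI)
  show "abelian_group complex_ring"
    by (rule abelian_groupI) (auto intro: exI[of _ "- _"])
  show "comm_monoid complex_ring"
    by (rule comm_monoidI) auto
qed (auto simp: algebra_simps)

text \<open>Differences are written \<open>x \<oplus> (-1) \<odot> y\<close> wherever an algebra is constructed: the constructions below
  define addition and scalar multiplication by formulas, whereas the additive inverse of a record is
  a description that has to be identified first.\<close>

lemma module_uminus_eq_smult:
  assumes "module complex_ring A" and "x \<in> carrier A"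
  shows "\<ominus>\<^bsub>A\<^esub> x = (-1) \<odot>\<^bsub>A\<^esub> x"
proof -
  interpret module complex_ring A by fact
  have "(-1) \<odot>\<^bsub>A\<^esub> x \<oplus>\<^bsub>A\<^esub> x = (-1 + 1) \<odot>\<^bsub>A\<^esub> x"
    using smult_l_distr[of "-1" 1 x] smult_one[of x] assms(2) by simp
  also have "\<dots> = \<zero>\<^bsub>A\<^esub>"
    using smult_l_null[of x] assms(2) by simp
  finally show ?thesis
    using assms(2) by (intro M.minus_equality) auto
qed

lemma module_minus_eq_smult:
  assumes "module complex_ring A" and "x \<in> carrier A" and "y \<in> carrier A"
  shows "x \<ominus>\<^bsub>A\<^esub> y = x \<oplus>\<^bsub>A\<^esub> (-1) \<odot>\<^bsub>A\<^esub> y"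
  using assms by (simp add: a_minus_def module_uminus_eq_smult)

lemma Metric_space_cstar_dist:
  assumes "module complex_ring A"
    and nonneg: "\<And>x. x \<in> carrier A \<Longrightarrow> 0 \<le> nrm A x"
    and eq_0: "\<And>x. x \<in> carrier A \<Longrightarrow> nrm A x = 0 \<longleftrightarrow> x = \<zero>\<^bsub>A\<^esub>"
    and triangle: "\<And>x y. \<lbrakk>x \<in> carrier A; y \<in> carrier A\<rbrakk>
      \<Longrightarrow> nrm A (x \<oplus>\<^bsub>A\<^esub> y) \<le> nrm A x + nrm A y"
    and smult: "\<And>c x. x \<in> carrier A \<Longrightarrow> nrm A (c \<odot>\<^bsub>A\<^esub> x) = cmod c * nrm A x"
  shows "Metric_space (carrier A) (cstar_dist A)"
proof -
  interpret module complex_ring A by fact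
  have sym: "nrm A (x \<ominus>\<^bsub>A\<^esub> y) = nrm A (y \<ominus>\<^bsub>A\<^esub> x)" if "x \<in> carrier A" "y \<in> carrier A" for x y
  proof -
    have "x \<ominus>\<^bsub>A\<^esub> y = \<ominus>\<^bsub>A\<^esub> (y \<ominus>\<^bsub>A\<^esub> x)"
      using that by (simp add: a_minus_def M.minus_add M.a_comm)
    also have "\<dots> = (-1) \<odot>\<^bsub>A\<^esub> (y \<ominus>\<^bsub>A\<^esub> x)"
      using that assms(1) by (intro module_uminus_eq_smult) auto
    finally show ?thesis using smult[of "y \<ominus>\<^bsub>A\<^esub> x" "-1"] that by simp
  qed
  have tri: "nrm A (x \<ominus>\<^bsub>A\<^esub> z) \<le> nrm A (x \<ominus>\<^bsub>A\<^esub> y) + nrm A (y \<ominus>\<^bsub>A\<^esub> z)"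
    if "x \<in> carrier A" "y \<in> carrier A" "z \<in> carrier A" for x y z
  proof -
    have "x \<ominus>\<^bsub>A\<^esub> z = (x \<ominus>\<^bsub>A\<^esub> y) \<oplus>\<^bsub>A\<^esub> (y \<ominus>\<^bsub>A\<^esub> z)"
      using that by (simp add: a_minus_def M.a_assoc M.r_neg1)
    then show ?thesis using triangle[of "x \<ominus>\<^bsub>A\<^esub> y" "y \<ominus>\<^bsub>A\<^esub> z"] that by simp
  qed
  have zero: "x \<ominus>\<^bsub>A\<^esub> y = \<zero>\<^bsub>A\<^esub> \<longleftrightarrow> x = y" if "x \<in> carrier A" "y \<in> carrier A" for x y
    using that by (metis M.a_inv_closed M.add.inv_equality M.minus_eq M.minus_minus M.r_neg)
  show ?thesis
    by unfold_locales (auto simp: cstar_dist_def nonneg eq_0 zero intro: sym tri)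
qed

text \<open>An introduction rule in which completeness is stated by Cauchy sequences and norms, so that
  constructions need not deal with the metric, whose values off the carrier are artificial.\<close>

lemma cstar_algebraI:
  fixes A :: "'a cstar" (structure)
  assumes zero_closed: "\<zero> \<in> carrier A"
    and add_closed: "\<And>x y. \<lbrakk>x \<in> carrier A; y \<in> carrier A\<rbrakk> \<Longrightarrow> x \<oplus> y \<in> carrier A"
    and smult_closed: "\<And>c x. x \<in> carrier A \<Longrightarrow> c \<odot> x \<in> carrier A"
    and mult_closed: "\<And>x y. \<lbrakk>x \<in> carrier A; y \<in> carrier A\<rbrakk> \<Longrightarrow> x \<otimes> y \<in> carrier A"
    and adj_closed: "\<And>x. x \<in> carrier A \<Longrightarrow> adj A x \<in> carrier A"
    and add_assoc: "\<And>x y z. \<lbrakk>x \<in> carrier A; y \<in> carrier A; z \<in> carrier A\<rbrakk>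
      \<Longrightarrow> (x \<oplus> y) \<oplus> z = x \<oplus> (y \<oplus> z)"
    and add_comm: "\<And>x y. \<lbrakk>x \<in> carrier A; y \<in> carrier A\<rbrakk> \<Longrightarrow> x \<oplus> y = y \<oplus> x"
    and zero_add: "\<And>x. x \<in> carrier A \<Longrightarrow> \<zero> \<oplus> x = x"
    and zero_smult: "\<And>x. x \<in> carrier A \<Longrightarrow> 0 \<odot> x = \<zero>"
    and one_smult: "\<And>x. x \<in> carrier A \<Longrightarrow> 1 \<odot> x = x"
    and smult_assoc: "\<And>c d x. x \<in> carrier A \<Longrightarrow> (c * d) \<odot> x = c \<odot> (d \<odot> x)"
    and smult_add_left: "\<And>c d x. x \<in> carrier A \<Longrightarrow> (c + d) \<odot> x = c \<odot> x \<oplus> d \<odot> x"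
    and smult_add_right: "\<And>c x y. \<lbrakk>x \<in> carrier A; y \<in> carrier A\<rbrakk>
      \<Longrightarrow> c \<odot> (x \<oplus> y) = c \<odot> x \<oplus> c \<odot> y"
    and mult_assoc: "\<And>x y z. \<lbrakk>x \<in> carrier A; y \<in> carrier A; z \<in> carrier A\<rbrakk>
      \<Longrightarrow> (x \<otimes> y) \<otimes> z = x \<otimes> (y \<otimes> z)"
    and mult_l_distr: "\<And>x y z. \<lbrakk>x \<in> carrier A; y \<in> carrier A; z \<in> carrier A\<rbrakk>
      \<Longrightarrow> (x \<oplus> y) \<otimes> z = x \<otimes> z \<oplus> y \<otimes> z"
    and mult_r_distr: "\<And>x y z. \<lbrakk>x \<in> carrier A; y \<in> carrier A; z \<in> carrier A\<rbrakk>
      \<Longrightarrow> z \<otimes> (x \<oplus> y) = z \<otimes> x \<oplus> z \<otimes> y"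
    and smult_mult_left: "\<And>c x y. \<lbrakk>x \<in> carrier A; y \<in> carrier A\<rbrakk>
      \<Longrightarrow> (c \<odot> x) \<otimes> y = c \<odot> (x \<otimes> y)"
    and smult_mult_right: "\<And>c x y. \<lbrakk>x \<in> carrier A; y \<in> carrier A\<rbrakk>
      \<Longrightarrow> x \<otimes> (c \<odot> y) = c \<odot> (x \<otimes> y)"
    and adj_adj: "\<And>x. x \<in> carrier A \<Longrightarrow> adj A (adj A x) = x"
    and adj_add: "\<And>x y. \<lbrakk>x \<in> carrier A; y \<in> carrier A\<rbrakk>
      \<Longrightarrow> adj A (x \<oplus> y) = adj A x \<oplus> adj A y"
    and adj_smult: "\<And>c x. x \<in> carrier A \<Longrightarrow> adj A (c \<odot> x) = cnj c \<odot> adj A x"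
    and adj_mult: "\<And>x y. \<lbrakk>x \<in> carrier A; y \<in> carrier A\<rbrakk>
      \<Longrightarrow> adj A (x \<otimes> y) = adj A y \<otimes> adj A x"
    and nrm_nonneg: "\<And>x. x \<in> carrier A \<Longrightarrow> 0 \<le> nrm A x"
    and nrm_eq_0_iff: "\<And>x. x \<in> carrier A \<Longrightarrow> nrm A x = 0 \<longleftrightarrow> x = \<zero>"
    and nrm_triangle: "\<And>x y. \<lbrakk>x \<in> carrier A; y \<in> carrier A\<rbrakk>
      \<Longrightarrow> nrm A (x \<oplus> y) \<le> nrm A x + nrm A y"
    and nrm_smult: "\<And>c x. x \<in> carrier A \<Longrightarrow> nrm A (c \<odot> x) = cmod c * nrm A x"
    and nrm_mult: "\<And>x y. \<lbrakk>x \<in> carrier A; y \<in> carrier A\<rbrakk>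
      \<Longrightarrow> nrm A (x \<otimes> y) \<le> nrm A x * nrm A y"
    and nrm_cstar: "\<And>x. x \<in> carrier A \<Longrightarrow> nrm A (adj A x \<otimes> x) = (nrm A x)\<^sup>2"
    and complete: "\<And>\<sigma>. \<lbrakk>\<And>k. \<sigma> k \<in> carrier A;
      \<And>e. e > 0 \<Longrightarrow> \<exists>N. \<forall>i\<ge>N. \<forall>j\<ge>N. nrm A (\<sigma> i \<oplus> (-1) \<odot> \<sigma> j) < e\<rbrakk>
      \<Longrightarrow> \<exists>l\<in>carrier A. (\<lambda>k. nrm A (\<sigma> k \<oplus> (-1) \<odot> l)) \<longlonglongrightarrow> 0"
  shows "cstar_algebra A"
proof -
  have "\<exists>y\<in>carrier A. y \<oplus> x = \<zero>" if "x \<in> carrier A" for x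
    using smult_add_left[OF that, of "-1" 1] that
    by (intro bexI[of _ "(-1) \<odot> x"]) (simp_all add: one_smult zero_smult smult_closed)
  then have "abelian_group A"
    by (intro abelian_groupI) (auto intro: zero_closed add_closed add_assoc add_comm zero_add)
  then have mod: "module complex_ring A"
    by (intro moduleI cring_complex_ring)
      (auto intro: smult_closed smult_add_left smult_add_right smult_assoc one_smult)
  interpret M: Metric_space "carrier A" "cstar_dist A"
    by (intro Metric_space_cstar_dist mod nrm_nonneg nrm_eq_0_iff nrm_triangle nrm_smult)
  have "M.mcomplete"
    unfolding M.mcomplete_def
  proof (intro allI impI)
    fix \<sigma> assume \<sigma>: "M.MCauchy \<sigma>"
    then have in_A: "\<sigma> k \<in> carrier A" for k
      by (auto simp: M.MCauchy_def)
    have "\<exists>N. \<forall>i\<ge>N. \<forall>j\<ge>N. nrm A (\<sigma> i \<oplus> (-1) \<odot> \<sigma> j) < e" if "e > 0" for e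
      using \<sigma> that in_A by (simp add: M.MCauchy_def cstar_dist_def module_minus_eq_smult[OF mod])
    then obtain l where "l \<in> carrier A" "(\<lambda>k. nrm A (\<sigma> k \<oplus> (-1) \<odot> l)) \<longlonglongrightarrow> 0"
      using complete[of \<sigma>] in_A by blast
    then have "limitin M.mtopology \<sigma> l sequentially"
      using in_A by (simp add: M.limitin_metric_dist_null cstar_dist_def module_minus_eq_smult[OF mod])
    then show "\<exists>l. limitin M.mtopology \<sigma> l sequentially" ..
  qed
  show ?thesis
    by (intro cstar_algebra.intro mod cstar_algebra_axioms.intro)
      (fact \<open>M.mcomplete\<close> mult_closed mult_assoc mult_l_distr mult_r_distr smult_mult_left smult_mult_right
        adj_closed adj_adj adj_add adj_smult adj_mult nrm_nonneg nrm_eq_0_iff nrm_triangle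
        nrm_smult nrm_mult nrm_cstar)+
qed

section \<open>Convergence in a C*-algebra\<close>

context cstar_algebra
begin

sublocale metric: Metric_space "carrier A" "cstar_dist A"
  by (intro Metric_space_cstar_dist module_axioms nrm_nonneg nrm_eq_0_iff nrm_triangle nrm_smult)

text \<open>Convergence along an arbitrary filter serves both for sequences (completeness, closedness) and for
  the continuity of paths.\<close>

lemma limitin_iff:
  "limitin (cstar_topology A) f l F \<longleftrightarrow>
     l \<in> carrier A \<and> (\<forall>\<^sub>F x in F. f x \<in> carrier A) \<and> ((\<lambda>x. nrm A (f x \<ominus> l)) \<longlongrightarrow> 0) F"
proof -
  have "((\<lambda>x. cstar_dist A (f x) l) \<longlongrightarrow> 0) F \<longleftrightarrow> ((\<lambda>x. nrm A (f x \<ominus> l)) \<longlongrightarrow> 0) F"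
    if "l \<in> carrier A" "\<forall>\<^sub>F x in F. f x \<in> carrier A"
    using that(2) that(1)
    by (intro tendsto_cong) (auto elim!: eventually_mono simp: cstar_dist_def)
  then show ?thesis
    by (auto simp: cstar_topology_def metric.limitin_metric_dist_null)
qed

lemma topspace_cstar_topology [simp]: "topspace (cstar_topology A) = carrier A"
  by (simp add: cstar_topology_def)

lemma limitin_unique:
  "\<lbrakk>limitin (cstar_topology A) f l F; limitin (cstar_topology A) f m F; F \<noteq> bot\<rbrakk> \<Longrightarrow> l = m"
  unfolding cstar_topology_def by (rule metric.limitin_metric_unique)

lemma minus_eq_smult: "\<lbrakk>x \<in> carrier A; y \<in> carrier A\<rbrakk> \<Longrightarrow> x \<ominus> y = x \<oplus> (-1) \<odot> y"
  by (rule module_minus_eq_smult[OF module_axioms])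

lemma smult_smult: "x \<in> carrier A \<Longrightarrow> c \<odot> (d \<odot> x) = (c * d) \<odot> x"
  using smult_assoc1[of c d x] by simp

lemma smult_add: "\<lbrakk>x \<in> carrier A; y \<in> carrier A\<rbrakk> \<Longrightarrow> c \<odot> (x \<oplus> y) = c \<odot> x \<oplus> c \<odot> y"
  using smult_r_distr[of c x y] by simp

lemma add_smult: "x \<in> carrier A \<Longrightarrow> (c + d) \<odot> x = c \<odot> x \<oplus> d \<odot> x"
  using smult_l_distr[of c d x] by simp

lemma one_smult [simp]: "x \<in> carrier A \<Longrightarrow> 1 \<odot> x = x"
  using smult_one[of x] by simp

lemma zero_smult [simp]: "x \<in> carrier A \<Longrightarrow> 0 \<odot> x = \<zero>"
  using smult_l_null[of x] by simp

lemma smult_in_carrier [simp]: "x \<in> carrier A \<Longrightarrow> c \<odot> x \<in> carrier A"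
  using smult_closed[of c x] by simp

declare mult_closed [simp] adj_closed [simp] adj_adj [simp]

lemma minus_add_minus:
  assumes "x \<in> carrier A" "y \<in> carrier A" "z \<in> carrier A"
  shows "x \<ominus> z = (x \<ominus> y) \<oplus> (y \<ominus> z)"
  using assms by (simp add: a_minus_def M.a_assoc M.r_neg1)

lemma nrm_zero [simp]: "nrm A \<zero> = 0"
  by (simp add: nrm_eq_0_iff)

lemma nrm_adj: "x \<in> carrier A \<Longrightarrow> nrm A (adj A x) = nrm A x"
proof -
  have le: "nrm A x \<le> nrm A (adj A x)" if "x \<in> carrier A" for x
  proof (cases "nrm A x = 0")
    case False
    have "nrm A x * nrm A x \<le> nrm A (adj A x) * nrm A x"
      using nrm_cstar[OF that] nrm_mult[of "adj A x" x] that by (simp add: power2_eq_square)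
    then show ?thesis
      using False nrm_nonneg[OF that] by (simp add: mult_le_cancel_right)
  qed (use that in \<open>simp add: nrm_nonneg\<close>)
  show "x \<in> carrier A \<Longrightarrow> nrm A (adj A x) = nrm A x"
    using le[of x] le[of "adj A x"] by simp
qed

lemma nrm_minus_commute: "\<lbrakk>x \<in> carrier A; y \<in> carrier A\<rbrakk> \<Longrightarrow> nrm A (x \<ominus> y) = nrm A (y \<ominus> x)"
  using metric.commute[of x y] by (simp add: cstar_dist_def)

lemma nrm_minus_ge: "\<lbrakk>x \<in> carrier A; y \<in> carrier A\<rbrakk> \<Longrightarrow> \<bar>nrm A x - nrm A y\<bar> \<le> nrm A (x \<ominus> y)"
proof -
  have "nrm A x \<le> nrm A (x \<ominus> y) + nrm A y" if "x \<in> carrier A" "y \<in> carrier A" for x y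
    using nrm_triangle[of "x \<ominus> y" y] that by (simp add: a_minus_def M.a_assoc M.l_neg)
  then show "\<lbrakk>x \<in> carrier A; y \<in> carrier A\<rbrakk> \<Longrightarrow> \<bar>nrm A x - nrm A y\<bar> \<le> nrm A (x \<ominus> y)"
    using nrm_minus_commute[of x y] by (force simp: abs_le_iff algebra_simps)
qed

lemma minus_add_distrib:
  assumes "x \<in> carrier A" "y \<in> carrier A" "z \<in> carrier A" "w \<in> carrier A"
  shows "(x \<oplus> y) \<ominus> (z \<oplus> w) = (x \<ominus> z) \<oplus> (y \<ominus> w)"
  using assms by (simp add: a_minus_def M.minus_add M.a_ac)

lemma minus_smult_distrib:
  assumes "x \<in> carrier A" "y \<in> carrier A"
  shows "c \<odot> x \<ominus> c \<odot> y = c \<odot> (x \<ominus> y)"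
  using assms by (simp add: minus_eq_smult smult_add smult_smult)

lemma minus_adj_distrib:
  assumes "x \<in> carrier A" "y \<in> carrier A"
  shows "adj A x \<ominus> adj A y = adj A (x \<ominus> y)"
  using assms by (simp add: minus_eq_smult adj_add adj_smult)

text \<open>The telescoping identity behind the continuity of multiplication and behind the contraction estimate
  for the iteration that produces a square root.\<close>

lemma minus_mult_distrib:
  assumes "x \<in> carrier A" "y \<in> carrier A" "z \<in> carrier A" "w \<in> carrier A"
  shows "x \<otimes> y \<ominus> z \<otimes> w = (x \<ominus> z) \<otimes> y \<oplus> z \<otimes> (y \<ominus> w)"
proof -
  have "(x \<ominus> z) \<otimes> y = x \<otimes> y \<ominus> z \<otimes> y" "z \<otimes> (y \<ominus> w) = z \<otimes> y \<ominus> z \<otimes> w"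
    using assms
    by (simp_all add: minus_eq_smult mult_l_distr mult_r_distr smult_mult_left smult_mult_right)
  then show ?thesis
    using minus_add_minus[of "x \<otimes> y" "z \<otimes> y" "z \<otimes> w"] assms by simp
qed

lemma limitin_add:
  assumes "limitin (cstar_topology A) f l F" "limitin (cstar_topology A) g m F"
  shows "limitin (cstar_topology A) (\<lambda>x. f x \<oplus> g x) (l \<oplus> m) F"
proof -
  have in_A: "\<forall>\<^sub>F x in F. f x \<in> carrier A \<and> g x \<in> carrier A"
    using assms by (simp add: limitin_iff eventually_conj)
  have "((\<lambda>x. nrm A (f x \<ominus> l) + nrm A (g x \<ominus> m)) \<longlongrightarrow> 0) F"
    using assms by (intro tendsto_add_zero) (simp_all add: limitin_iff)
  moreover have "\<forall>\<^sub>F x in F. norm (nrm A ((f x \<oplus> g x) \<ominus> (l \<oplus> m))) \<le> nrm A (f x \<ominus> l) + nrm A (g x \<ominus> m)"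
    using in_A assms
    by (auto elim!: eventually_mono simp: limitin_iff minus_add_distrib nrm_nonneg nrm_triangle)
  ultimately have "((\<lambda>x. nrm A ((f x \<oplus> g x) \<ominus> (l \<oplus> m))) \<longlongrightarrow> 0) F"
    by (rule Lim_null_comparison[rotated])
  then show ?thesis
    using in_A assms by (auto simp: limitin_iff elim: eventually_mono)
qed

lemma limitin_smult:
  assumes "limitin (cstar_topology A) f l F"
  shows "limitin (cstar_topology A) (\<lambda>x. c \<odot> f x) (c \<odot> l) F"
proof -
  have in_A: "\<forall>\<^sub>F x in F. f x \<in> carrier A"
    using assms by (simp add: limitin_iff)
  have "((\<lambda>x. cmod c * nrm A (f x \<ominus> l)) \<longlongrightarrow> 0) F"
    using assms by (intro tendsto_mult_right_zero) (simp add: limitin_iff)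
  moreover have "\<forall>\<^sub>F x in F. norm (nrm A (c \<odot> f x \<ominus> c \<odot> l)) \<le> cmod c * nrm A (f x \<ominus> l)"
    using in_A assms
    by (auto elim!: eventually_mono simp: limitin_iff minus_smult_distrib nrm_nonneg nrm_smult)
  ultimately have "((\<lambda>x. nrm A (c \<odot> f x \<ominus> c \<odot> l)) \<longlongrightarrow> 0) F"
    by (rule Lim_null_comparison[rotated])
  then show ?thesis
    using in_A assms by (auto simp: limitin_iff elim: eventually_mono)
qed

lemma limitin_adj:
  assumes "limitin (cstar_topology A) f l F"
  shows "limitin (cstar_topology A) (\<lambda>x. adj A (f x)) (adj A l) F"
proof -
  have in_A: "\<forall>\<^sub>F x in F. f x \<in> carrier A"
    using assms by (simp add: limitin_iff)
  moreover have "\<forall>\<^sub>F x in F. norm (nrm A (adj A (f x) \<ominus> adj A l)) \<le> nrm A (f x \<ominus> l)"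
    using in_A assms
    by (auto elim!: eventually_mono simp: limitin_iff minus_adj_distrib nrm_nonneg nrm_adj)
  then have "((\<lambda>x. nrm A (adj A (f x) \<ominus> adj A l)) \<longlongrightarrow> 0) F"
    by (rule Lim_null_comparison) (use assms in \<open>simp add: limitin_iff\<close>)
  ultimately show ?thesis
    using assms by (auto simp: limitin_iff elim: eventually_mono)
qed

lemma limitin_nrm:
  assumes "limitin (cstar_topology A) f l F"
  shows "((\<lambda>x. nrm A (f x)) \<longlongrightarrow> nrm A l) F"
proof -
  have "\<forall>\<^sub>F x in F. norm (nrm A (f x) - nrm A l) \<le> nrm A (f x \<ominus> l)"
    using assms by (auto elim!: eventually_mono simp: limitin_iff nrm_minus_ge)
  then have "((\<lambda>x. nrm A (f x) - nrm A l) \<longlongrightarrow> 0) F"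
    by (rule Lim_null_comparison) (use assms in \<open>simp add: limitin_iff\<close>)
  then show ?thesis by (simp add: LIM_zero_iff)
qed

lemma limitin_mult:
  assumes "limitin (cstar_topology A) f l F" "limitin (cstar_topology A) g m F"
  shows "limitin (cstar_topology A) (\<lambda>x. f x \<otimes> g x) (l \<otimes> m) F"
proof -
  have in_A: "\<forall>\<^sub>F x in F. f x \<in> carrier A \<and> g x \<in> carrier A" and l: "l \<in> carrier A" "m \<in> carrier A"
    using assms by (simp_all add: limitin_iff eventually_conj)
  have "((\<lambda>x. nrm A (f x \<ominus> l) * nrm A (g x) + nrm A l * nrm A (g x \<ominus> m))
      \<longlongrightarrow> 0 * nrm A m + nrm A l * 0) F"
    using assms limitin_nrm[OF assms(2)] by (intro tendsto_intros) (simp_all add: limitin_iff)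
  then have "((\<lambda>x. nrm A (f x \<ominus> l) * nrm A (g x) + nrm A l * nrm A (g x \<ominus> m)) \<longlongrightarrow> 0) F"
    by simp
  moreover have "\<forall>\<^sub>F x in F. norm (nrm A (f x \<otimes> g x \<ominus> l \<otimes> m))
      \<le> nrm A (f x \<ominus> l) * nrm A (g x) + nrm A l * nrm A (g x \<ominus> m)"
    using in_A
  proof eventually_elim
    case (elim x)
    then show ?case
      using nrm_triangle[of "(f x \<ominus> l) \<otimes> g x" "l \<otimes> (g x \<ominus> m)"] l
        nrm_mult[of "f x \<ominus> l" "g x"] nrm_mult[of l "g x \<ominus> m"]
      by (simp add: minus_mult_distrib nrm_nonneg)
  qed
  ultimately have "((\<lambda>x. nrm A (f x \<otimes> g x \<ominus> l \<otimes> m)) \<longlongrightarrow> 0) F"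
    by (rule Lim_null_comparison[rotated])
  then show ?thesis
    using in_A l by (auto simp: limitin_iff elim: eventually_mono)
qed

lemma limitin_const: "l \<in> carrier A \<Longrightarrow> limitin (cstar_topology A) (\<lambda>_. l) l F"
  unfolding limitin_iff by (simp add: a_minus_def M.r_neg)

end

section \<open>Morphisms are contractive\<close>

text \<open>In the unitisation, \<open>v = 1 - sqrt (1 - x\<^sup>2)\<close> satisfies \<open>2 v = x\<^sup>2 + v\<^sup>2\<close>. This equation mentions no unit,
  and its solution is the fixed point of \<open>v \<mapsto> (x\<^sup>2 + v\<^sup>2) / 2\<close>, which is a contraction with constant
  \<open>\<parallel>x\<parallel> < 1\<close> on the ball of radius \<open>\<parallel>x\<parallel>\<close>. Running the iteration inside the self-adjoint elements that
  commute with \<open>x\<close>, a complete set, gives the two further properties of \<open>v\<close> for free.\<close>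

lemma (in cstar_algebra) ex_sqrt_complement:
  assumes x: "x \<in> carrier A" "adj A x = x" "nrm A x < 1"
  shows "\<exists>v\<in>carrier A. adj A v = v \<and> v \<otimes> x = x \<otimes> v \<and> v \<oplus> v = x \<otimes> x \<oplus> v \<otimes> v"
proof -
  define S where "S = {v \<in> carrier A. nrm A v \<le> nrm A x \<and> adj A v = v \<and> v \<otimes> x = x \<otimes> v}"
  define F where "F v = (1/2) \<odot> (x \<otimes> x \<oplus> v \<otimes> v)" for v
  interpret S: Submetric "carrier A" "cstar_dist A" S
    by unfold_locales (auto simp: S_def)
  have complete_S: "S.sub.mcomplete"
  proof (rule S.sequentially_closedin_mcomplete_imp_mcomplete[OF complete], safe)
    fix \<sigma> :: "nat \<Rightarrow> 'a" and l
    assume in_S: "range \<sigma> \<subseteq> S" and "limitin metric.mtopology \<sigma> l sequentially"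
    then have lim: "limitin (cstar_topology A) \<sigma> l sequentially"
      by (simp add: cstar_topology_def)
    have l: "l \<in> carrier A" using lim by (simp add: limitin_iff)
    have S: "\<sigma> k \<in> carrier A" "nrm A (\<sigma> k) \<le> nrm A x" "adj A (\<sigma> k) = \<sigma> k"
      "\<sigma> k \<otimes> x = x \<otimes> \<sigma> k" for k
      using in_S by (auto simp: S_def)
    have "nrm A l \<le> nrm A x"
      using limitin_nrm[OF lim] S(2) by (intro LIMSEQ_le_const2) auto
    moreover have "adj A l = l"
      using limitin_unique[OF limitin_adj[OF lim]] lim by (simp add: S(3))
    moreover have "l \<otimes> x = x \<otimes> l"
      using limitin_unique[OF limitin_mult[OF lim limitin_const[OF x(1)]]]
        limitin_mult[OF limitin_const[OF x(1)] lim] by (simp add: S(4))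
    ultimately show "l \<in> S" using l by (simp add: S_def)
  qed
  have F_in: "F v \<in> S" if "v \<in> S" for v
  proof -
    have v: "v \<in> carrier A" "nrm A v \<le> nrm A x" "adj A v = v" "v \<otimes> x = x \<otimes> v"
      using that by (auto simp: S_def)
    have "nrm A (x \<otimes> x \<oplus> v \<otimes> v) \<le> nrm A x * nrm A x + nrm A v * nrm A v"
      using nrm_triangle[of "x \<otimes> x" "v \<otimes> v"] nrm_mult[of x x] nrm_mult[of v v] x v by simp
    also have "\<dots> \<le> 1 * nrm A x + 1 * nrm A x"
      using x v nrm_nonneg by (intro add_mono mult_mono) auto
    finally have "nrm A (F v) \<le> nrm A x"
      using x v by (simp add: F_def nrm_smult norm_divide)
    moreover have "v \<otimes> v \<otimes> x = x \<otimes> (v \<otimes> v)"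
      using x v by (metis mult_assoc)
    then have "F v \<otimes> x = x \<otimes> F v"
      using x v by (simp add: F_def smult_mult_left smult_mult_right mult_l_distr mult_r_distr mult_assoc)
    ultimately show ?thesis
      using x v by (simp add: S_def F_def adj_smult adj_add adj_mult)
  qed
  have "S \<noteq> {}"
  proof -
    have "\<zero> \<in> S"
      using x nrm_nonneg[of x] adj_smult[of \<zero> 0] smult_mult_left[of \<zero> x 0] smult_mult_right[of x \<zero> 0]
      by (simp add: S_def)
    then show ?thesis by blast
  qed
  moreover have "cstar_dist A (F v) (F w) \<le> nrm A x * cstar_dist A v w" if "v \<in> S" "w \<in> S" for v w
  proof -
    have vw: "v \<in> carrier A" "w \<in> carrier A" "nrm A v \<le> nrm A x" "nrm A w \<le> nrm A x"
      using that by (auto simp: S_def)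
    have "F v \<ominus> F w = (1/2) \<odot> (v \<otimes> v \<ominus> w \<otimes> w)"
      using x vw by (simp add: F_def minus_smult_distrib minus_add_distrib)
        (simp add: a_minus_def M.r_neg)
    also have "\<dots> = (1/2) \<odot> ((v \<ominus> w) \<otimes> v \<oplus> w \<otimes> (v \<ominus> w))"
      using vw by (simp add: minus_mult_distrib)
    finally have "nrm A (F v \<ominus> F w) = nrm A ((v \<ominus> w) \<otimes> v \<oplus> w \<otimes> (v \<ominus> w)) / 2"
      using vw by (simp add: nrm_smult norm_divide)
    also have "nrm A ((v \<ominus> w) \<otimes> v \<oplus> w \<otimes> (v \<ominus> w)) \<le> nrm A (v \<ominus> w) * nrm A v + nrm A w * nrm A (v \<ominus> w)"
      using nrm_triangle[of "(v \<ominus> w) \<otimes> v" "w \<otimes> (v \<ominus> w)"]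
        nrm_mult[of "v \<ominus> w" v] nrm_mult[of w "v \<ominus> w"] vw by simp
    also have "\<dots> \<le> nrm A (v \<ominus> w) * nrm A x + nrm A x * nrm A (v \<ominus> w)"
      using x vw nrm_nonneg by (intro add_mono mult_mono) auto
    finally show ?thesis
      using vw F_in that by (simp add: cstar_dist_def S_def)
  qed
  ultimately obtain v where v: "v \<in> S" "F v = v"
    using S.sub.Banach_fixedpoint_thm[OF complete_S, of F "nrm A x"] F_in x by blast
  have "v \<oplus> v = F v \<oplus> F v" using v by simp
  also have "\<dots> = x \<otimes> x \<oplus> v \<otimes> v"
    using x v add_smult[of "x \<otimes> x \<oplus> v \<otimes> v" "1/2" "1/2"] by (simp add: F_def S_def)
  finally show ?thesis
    using v by (auto simp: S_def)
qed

text \<open>With \<open>w = 1 - u\<close> the hypothesis says \<open>y\<^sup>2 + w\<^sup>2 = 1\<close> in the unitisation, for commuting self-adjoint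
  \<open>y\<close> and \<open>w\<close>. So \<open>y \<plusminus> i w\<close> are unitary, multiplying by them preserves norms, and their mean \<open>y\<close>
  satisfies \<open>\<parallel>y z\<parallel> \<le> \<parallel>z\<parallel>\<close>; the choice \<open>z = y\<close> gives \<open>\<parallel>y\<parallel>\<^sup>2 \<le> \<parallel>y\<parallel>\<close>. Only products with \<open>z = y\<close> occur below,
  namely \<open>p = y z\<close> and \<open>q = w z\<close>, and these lie in the algebra itself.\<close>
lemma (in cstar_algebra) nrm_le_1_of_circle:
  assumes y: "y \<in> carrier A" "adj A y = y" and u: "u \<in> carrier A" "adj A u = u"
    and comm: "u \<otimes> y = y \<otimes> u" and circle: "u \<oplus> u = y \<otimes> y \<oplus> u \<otimes> u"
  shows "nrm A y \<le> 1"
proof -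
  define p where "p = y \<otimes> y"
  define q where "q = y \<ominus> u \<otimes> y"
  have [simp]: "p \<in> carrier A" "q \<in> carrier A" using y u by (auto simp: p_def q_def)
  have adj_q: "adj A q = y \<oplus> (-1) \<odot> (y \<otimes> u)"
    using y u by (simp add: q_def minus_eq_smult adj_add adj_smult adj_mult)
  have adj_p: "adj A p = p" using y by (simp add: p_def adj_mult)
  have q': "q = y \<oplus> (-1) \<odot> (u \<otimes> y)" using y u by (simp add: q_def minus_eq_smult)
  have comm': "u \<otimes> (y \<otimes> r) = y \<otimes> (u \<otimes> r)" if "r \<in> carrier A" for r
    using y u that comm by (metis mult_assoc)
  have pq: "adj A p \<otimes> q = adj A q \<otimes> p"
    using y u unfolding adj_p adj_q unfolding q' p_def
    by (simp add: mult_l_distr mult_r_distr smult_mult_left smult_mult_right mult_assoc comm comm')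
  have pp: "adj A p \<otimes> p \<oplus> adj A q \<otimes> q = y \<otimes> y"
  proof -
    let ?r = "y \<otimes> y" and ?t = "y \<otimes> (u \<otimes> y)" and ?s = "y \<otimes> (u \<otimes> (u \<otimes> y))"
    have "adj A p \<otimes> p \<oplus> ?s = y \<otimes> ((y \<otimes> y \<oplus> u \<otimes> u) \<otimes> y)"
      using y u unfolding adj_p unfolding p_def by (simp add: mult_l_distr mult_r_distr mult_assoc)
    also have "\<dots> = ?t \<oplus> ?t"
      using y u by (simp add: circle[symmetric] mult_l_distr mult_r_distr)
    finally have 1: "adj A p \<otimes> p \<oplus> ?s = ?t \<oplus> ?t" .
    have 2: "adj A q \<otimes> q = (?r \<oplus> \<ominus> (?t \<oplus> ?t)) \<oplus> ?s"
      using y u unfolding adj_q unfolding q'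
      by (simp add: mult_l_distr mult_r_distr smult_mult_left smult_mult_right mult_assoc
        smult_smult smult_add module_uminus_eq_smult[OF module_axioms] M.a_ac)
    have "adj A p \<otimes> p \<oplus> adj A q \<otimes> q = (adj A p \<otimes> p \<oplus> ?s) \<oplus> (?r \<oplus> \<ominus> (?t \<oplus> ?t))"
      using y u unfolding 2 by (simp add: M.a_ac)
    also have "\<dots> = ?r"
      using y u unfolding 1 by (simp add: M.r_neg2 M.a_lcomm[of "?t \<oplus> ?t" ?r] M.r_neg del: M.minus_add)
    finally show ?thesis .
  qed
  \<comment> \<open>the two unitaries, applied to \<open>z\<close>, are the cases \<open>c = \<i>\<close> and \<open>c = -\<i>\<close>\<close>
  have nrm_unitary: "nrm A (p \<oplus> c \<odot> q) = nrm A y" if c: "cnj c = - c" "cmod c = 1" for c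
  proof -
    have cc: "c * cnj c = 1" using c(2) by (metis complex_norm_square of_real_1 one_power2)
    have "adj A (p \<oplus> c \<odot> q) \<otimes> (p \<oplus> c \<odot> q)
      = (adj A p \<otimes> p \<oplus> adj A q \<otimes> q) \<oplus> (c \<odot> (adj A p \<otimes> q) \<oplus> cnj c \<odot> (adj A q \<otimes> p))"
      using cc by (simp add: adj_add adj_smult mult_l_distr mult_r_distr smult_mult_left
        smult_mult_right smult_smult smult_add mult.commute M.a_ac)
    also have "\<dots> = adj A y \<otimes> y"
      using y u add_smult[of "adj A q \<otimes> p" c "cnj c"] c(1) by (simp add: pp pq)
    finally have "(nrm A (p \<oplus> c \<odot> q))\<^sup>2 = (nrm A y)\<^sup>2"
      using nrm_cstar[of "p \<oplus> c \<odot> q"] nrm_cstar[of y] y by simp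
    then show ?thesis using y by (simp add: nrm_nonneg)
  qed
  have "\<i> \<odot> q \<oplus> (-\<i>) \<odot> q = \<zero>"
    using add_smult[of q \<i> "-\<i>"] by simp
  then have "p \<oplus> p = (p \<oplus> \<i> \<odot> q) \<oplus> (p \<oplus> (-\<i>) \<odot> q)"
    by (simp add: M.a_ac)
  then have "2 \<odot> p = (p \<oplus> \<i> \<odot> q) \<oplus> (p \<oplus> (-\<i>) \<odot> q)"
    using add_smult[of p 1 1] by simp
  then have "2 * nrm A p \<le> nrm A y + nrm A y"
    using nrm_triangle[of "p \<oplus> \<i> \<odot> q" "p \<oplus> (-\<i>) \<odot> q"] nrm_smult[of p 2]
    by (simp add: nrm_unitary)
  then have "(nrm A y)\<^sup>2 \<le> nrm A y"
    using nrm_cstar[of y] y by (simp add: p_def)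
  then show ?thesis
    using nrm_nonneg[OF y(1)] mult_le_cancel_right[of "nrm A y" "nrm A y" 1]
    by (cases "nrm A y = 0") (auto simp: power2_eq_square)
qed

context cstar_hom
begin

text \<open>Morphisms of C*-algebras are automatically continuous. The usual argument compares spectral radii;
  here the relation that characterises \<open>1 - sqrt (1 - x\<^sup>2)\<close> is transported by the morphism and bounds
  the norm of the image of \<open>x\<close> directly. The C*-identity reduces the general case to self-adjoint
  elements.\<close>

lemma contractive:
  assumes "x \<in> carrier A"
  shows "nrm B (h x) \<le> nrm A x"
proof -
  have le_1: "nrm B (h x) \<le> 1" if x: "x \<in> carrier A" "adj A x = x" "nrm A x < 1" for x
  proof -
    obtain v where "v \<in> carrier A" "adj A v = v" "v \<otimes>\<^bsub>A\<^esub> x = x \<otimes>\<^bsub>A\<^esub> v"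
      "v \<oplus>\<^bsub>A\<^esub> v = x \<otimes>\<^bsub>A\<^esub> x \<oplus>\<^bsub>A\<^esub> v \<otimes>\<^bsub>A\<^esub> v"
      using A.ex_sqrt_complement[OF x] by blast
    then show ?thesis
      using x by (intro B.nrm_le_1_of_circle[of "h x" "h v"])
        (simp_all add: hom_closed flip: hom_adj hom_mult hom_add)
  qed
  have selfadjoint: "nrm B (h x) \<le> nrm A x" if x: "x \<in> carrier A" "adj A x = x" for x
  proof (rule field_le_epsilon)
    fix e :: real assume e: "e > 0"
    define r where "r = nrm A x + e"
    have r: "r > 0" "nrm A x < r" using e A.nrm_nonneg[OF x(1)] by (auto simp: r_def)
    have "nrm B (h (of_real (1 / r) \<odot>\<^bsub>A\<^esub> x)) \<le> 1"
      using r x by (intro le_1) (simp_all add: A.adj_smult A.nrm_smult norm_divide)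
    then show "nrm B (h x) \<le> nrm A x + e"
      using r x by (simp add: hom_smult hom_closed B.nrm_smult norm_divide divide_simps flip: r_def)
  qed
  have "(nrm B (h x))\<^sup>2 = nrm B (h (adj A x \<otimes>\<^bsub>A\<^esub> x))"
    using assms B.nrm_cstar[of "h x"] by (simp add: hom_closed hom_mult hom_adj)
  also have "\<dots> \<le> nrm A (adj A x \<otimes>\<^bsub>A\<^esub> x)"
    using assms by (intro selfadjoint) (simp_all add: A.adj_mult)
  also have "\<dots> = (nrm A x)\<^sup>2"
    using assms by (rule A.nrm_cstar)
  finally show ?thesis
    using A.nrm_nonneg[OF assms] by (rule power2_le_imp_le)
qed

lemma hom_minus:
  "\<lbrakk>x \<in> carrier A; y \<in> carrier A\<rbrakk> \<Longrightarrow> h (x \<ominus>\<^bsub>A\<^esub> y) = h x \<ominus>\<^bsub>B\<^esub> h y"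
  by (simp add: A.minus_eq_smult B.minus_eq_smult hom_add hom_smult hom_closed)

lemma hom_zero: "h \<zero>\<^bsub>A\<^esub> = \<zero>\<^bsub>B\<^esub>"
  using hom_smult[of "\<zero>\<^bsub>A\<^esub>" 0] by (simp add: hom_closed)

lemma limitin_hom:
  assumes "limitin (cstar_topology A) f l F"
  shows "limitin (cstar_topology B) (\<lambda>x. h (f x)) (h l) F"
proof -
  have in_A: "\<forall>\<^sub>F x in F. f x \<in> carrier A" "l \<in> carrier A"
    using assms by (simp_all add: A.limitin_iff)
  have "\<forall>\<^sub>F x in F. norm (nrm B (h (f x) \<ominus>\<^bsub>B\<^esub> h l)) \<le> nrm A (f x \<ominus>\<^bsub>A\<^esub> l)"
    using in_A by (auto elim!: eventually_mono
        simp: B.nrm_nonneg hom_closed contractive simp flip: hom_minus)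
  then have "((\<lambda>x. nrm B (h (f x) \<ominus>\<^bsub>B\<^esub> h l)) \<longlongrightarrow> 0) F"
    by (rule Lim_null_comparison) (use assms in \<open>simp add: A.limitin_iff\<close>)
  then show ?thesis
    using in_A by (auto simp: B.limitin_iff hom_closed elim: eventually_mono)
qed

end

section \<open>Closed subalgebras and bounded products\<close>

context cstar_algebra
begin

lemma zero_in_carrier: "\<zero> \<in> carrier A"
  by simp

lemma add_in_carrier: "\<lbrakk>x \<in> carrier A; y \<in> carrier A\<rbrakk> \<Longrightarrow> x \<oplus> y \<in> carrier A"
  by simp

lemma add_assoc:
  "\<lbrakk>x \<in> carrier A; y \<in> carrier A; z \<in> carrier A\<rbrakk> \<Longrightarrow> (x \<oplus> y) \<oplus> z = x \<oplus> (y \<oplus> z)"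
  by (rule M.a_assoc)

lemma add_commute: "\<lbrakk>x \<in> carrier A; y \<in> carrier A\<rbrakk> \<Longrightarrow> x \<oplus> y = y \<oplus> x"
  by (rule M.a_comm)

lemma zero_add: "x \<in> carrier A \<Longrightarrow> \<zero> \<oplus> x = x"
  by simp

text \<open>The algebraic laws in the form in which they are used componentwise, without the scalar ring in the
  premises. Commutativity of addition is kept apart: as a
  rewrite rule it competes with the orientation chosen for associativity.\<close>

lemmas closure_laws = zero_in_carrier add_in_carrier smult_in_carrier mult_closed adj_closed

lemmas equational_laws = add_assoc zero_add zero_smult one_smult smult_smult smult_add add_smult
  mult_assoc mult_l_distr mult_r_distr smult_mult_left smult_mult_right adj_adj adj_add adj_smult
  adj_mult

lemma Cauchy_imp_limitin:
  assumes "\<And>k. \<sigma> k \<in> carrier A"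
    and "\<And>e. e > 0 \<Longrightarrow> \<exists>N. \<forall>i\<ge>N. \<forall>j\<ge>N. nrm A (\<sigma> i \<oplus> (-1) \<odot> \<sigma> j) < e"
  shows "\<exists>l. limitin (cstar_topology A) \<sigma> l sequentially"
proof -
  have "metric.MCauchy \<sigma>"
    using assms by (auto simp: metric.MCauchy_def cstar_dist_def minus_eq_smult)
  then show ?thesis
    using complete by (auto simp: metric.mcomplete_def cstar_topology_def)
qed

lemma limitin_iff_smult:
  "limitin (cstar_topology A) f l F \<longleftrightarrow>
     l \<in> carrier A \<and> (\<forall>\<^sub>F x in F. f x \<in> carrier A) \<and> ((\<lambda>x. nrm A (f x \<oplus> (-1) \<odot> l)) \<longlongrightarrow> 0) F"
proof -
  have "((\<lambda>x. nrm A (f x \<oplus> (-1) \<odot> l)) \<longlongrightarrow> 0) F \<longleftrightarrow> ((\<lambda>x. nrm A (f x \<ominus> l)) \<longlongrightarrow> 0) F"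
    if "l \<in> carrier A" "\<forall>\<^sub>F x in F. f x \<in> carrier A"
    using that(2) that(1)
    by (intro tendsto_cong) (auto elim!: eventually_mono simp: minus_eq_smult)
  then show ?thesis
    by (auto simp: limitin_iff)
qed

end

text \<open>The operations and the norm of \<open>B\<close> only have to agree with those of \<open>A\<close> on the carrier of \<open>B\<close>; the
  norm of a path algebra, for instance, is a different term from the norm of the product that
  contains it.\<close>

lemma cstar_algebra_closed_subalgebra:
  fixes A B :: "'a cstar"
  assumes "cstar_algebra A" and sub: "carrier B \<subseteq> carrier A" and zero: "\<zero>\<^bsub>B\<^esub> = \<zero>\<^bsub>A\<^esub>"
    and ops: "\<And>x y. \<lbrakk>x \<in> carrier B; y \<in> carrier B\<rbrakk> \<Longrightarrow> x \<oplus>\<^bsub>B\<^esub> y = x \<oplus>\<^bsub>A\<^esub> y"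
      "\<And>x y. \<lbrakk>x \<in> carrier B; y \<in> carrier B\<rbrakk> \<Longrightarrow> x \<otimes>\<^bsub>B\<^esub> y = x \<otimes>\<^bsub>A\<^esub> y"
      "\<And>c x. x \<in> carrier B \<Longrightarrow> c \<odot>\<^bsub>B\<^esub> x = c \<odot>\<^bsub>A\<^esub> x"
      "\<And>x. x \<in> carrier B \<Longrightarrow> adj B x = adj A x"
      "\<And>x. x \<in> carrier B \<Longrightarrow> nrm B x = nrm A x"
    and closed: "\<zero>\<^bsub>A\<^esub> \<in> carrier B"
      "\<And>x y. \<lbrakk>x \<in> carrier B; y \<in> carrier B\<rbrakk> \<Longrightarrow> x \<oplus>\<^bsub>A\<^esub> y \<in> carrier B"
      "\<And>x y. \<lbrakk>x \<in> carrier B; y \<in> carrier B\<rbrakk> \<Longrightarrow> x \<otimes>\<^bsub>A\<^esub> y \<in> carrier B"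
      "\<And>c x. x \<in> carrier B \<Longrightarrow> c \<odot>\<^bsub>A\<^esub> x \<in> carrier B"
      "\<And>x. x \<in> carrier B \<Longrightarrow> adj A x \<in> carrier B"
    and limit: "\<And>\<sigma> l. \<lbrakk>\<And>k. \<sigma> k \<in> carrier B; limitin (cstar_topology A) \<sigma> l sequentially\<rbrakk>
      \<Longrightarrow> l \<in> carrier B"
  shows "cstar_algebra B"
proof -
  interpret A: cstar_algebra A by fact
  note [simp] = zero ops closed
  have [simp, intro]: "x \<in> carrier B \<Longrightarrow> x \<in> carrier A" for x
    using sub by blast
  show ?thesis
  proof (rule cstar_algebraI)
    fix \<sigma> :: "nat \<Rightarrow> _" assume \<sigma>: "\<And>k. \<sigma> k \<in> carrier B"
      and "\<And>e. e > 0 \<Longrightarrow> \<exists>N. \<forall>i\<ge>N. \<forall>j\<ge>N. nrm B (\<sigma> i \<oplus>\<^bsub>B\<^esub> (-1) \<odot>\<^bsub>B\<^esub> \<sigma> j) < e"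
    then have "\<exists>N. \<forall>i\<ge>N. \<forall>j\<ge>N. nrm A (\<sigma> i \<oplus>\<^bsub>A\<^esub> (-1) \<odot>\<^bsub>A\<^esub> \<sigma> j) < e" if "e > 0" for e
      using that by simp
    then obtain l where l: "limitin (cstar_topology A) \<sigma> l sequentially"
      using A.Cauchy_imp_limitin[of \<sigma>] \<sigma> by blast
    moreover have "l \<in> carrier B"
      using limit \<sigma> l by blast
    ultimately show "\<exists>l\<in>carrier B. (\<lambda>k. nrm B (\<sigma> k \<oplus>\<^bsub>B\<^esub> (-1) \<odot>\<^bsub>B\<^esub> l)) \<longlonglongrightarrow> 0"
      using \<sigma> by (intro bexI[of _ l]) (simp_all add: A.limitin_iff_smult)
  qed (auto simp: A.equational_laws A.nrm_nonneg A.nrm_eq_0_iff A.nrm_triangle A.nrm_smult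
      A.nrm_mult A.nrm_cstar intro: A.add_commute)
qed

text \<open>The \<open>\<ell>\<^sup>\<infinity>\<close>-product, which contains finite direct sums and path algebras alike: the former are the case of
  a finite index set, the latter are the continuous elements of the product of copies of one
  algebra over the unit interval. The extra \<open>0\<close> in the supremum takes care of an empty index set.\<close>

definition bounded_product :: "'i set \<Rightarrow> ('i \<Rightarrow> 'a cstar) \<Rightarrow> ('i \<Rightarrow> 'a) cstar" where
  "bounded_product I A = (cstar_Sum I A)
     \<lparr>carrier := {x \<in> carrier (cstar_Sum I A). bdd_above ((\<lambda>i. nrm (A i) (x i)) ` I)},
      nrm := (\<lambda>x. Sup (insert 0 ((\<lambda>i. nrm (A i) (x i)) ` I)))\<rparr>"

lemma bounded_product_ops [simp]:
  "\<zero>\<^bsub>bounded_product I A\<^esub> = (\<lambda>i\<in>I. \<zero>\<^bsub>A i\<^esub>)"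
  "x \<oplus>\<^bsub>bounded_product I A\<^esub> y = (\<lambda>i\<in>I. x i \<oplus>\<^bsub>A i\<^esub> y i)"
  "x \<otimes>\<^bsub>bounded_product I A\<^esub> y = (\<lambda>i\<in>I. x i \<otimes>\<^bsub>A i\<^esub> y i)"
  "c \<odot>\<^bsub>bounded_product I A\<^esub> x = (\<lambda>i\<in>I. c \<odot>\<^bsub>A i\<^esub> x i)"
  "adj (bounded_product I A) x = (\<lambda>i\<in>I. adj (A i) (x i))"
  by (simp_all add: bounded_product_def cstar_Sum_def)

lemma carrier_bounded_product:
  "x \<in> carrier (bounded_product I A) \<longleftrightarrow>
     x \<in> (\<Pi>\<^sub>E i\<in>I. carrier (A i)) \<and> (\<exists>c. \<forall>i\<in>I. nrm (A i) (x i) \<le> c)"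
  by (auto simp: bounded_product_def cstar_Sum_def bdd_above_def)

lemma nrm_bounded_product_upper:
  assumes "x \<in> carrier (bounded_product I A)"
  shows "i \<in> I \<Longrightarrow> nrm (A i) (x i) \<le> nrm (bounded_product I A) x"
    and "0 \<le> nrm (bounded_product I A) x"
proof -
  have "bdd_above (insert 0 ((\<lambda>i. nrm (A i) (x i)) ` I))"
    using assms by (simp add: bounded_product_def)
  then show "i \<in> I \<Longrightarrow> nrm (A i) (x i) \<le> nrm (bounded_product I A) x"
    and "0 \<le> nrm (bounded_product I A) x"
    by (simp_all add: bounded_product_def cSup_upper)
qed

lemma nrm_bounded_product_least:
  assumes "\<And>i. i \<in> I \<Longrightarrow> nrm (A i) (x i) \<le> c" and "0 \<le> c"
  shows "nrm (bounded_product I A) x \<le> c"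
  using assms by (auto simp: bounded_product_def intro!: cSup_least)

text \<open>Everything but completeness holds componentwise. A Cauchy sequence converges in every component, and
  letting the second index of the Cauchy condition tend to infinity makes the convergence uniform.\<close>

lemma cstar_algebra_bounded_product:
  assumes C: "\<And>i. i \<in> I \<Longrightarrow> cstar_algebra (A i)"
  shows "cstar_algebra (bounded_product I A)"
proof -
  let ?P = "bounded_product I A"
  note [simp] = cstar_algebra.closure_laws[OF C] and eqs = cstar_algebra.equational_laws[OF C]
  note nonneg = cstar_algebra.nrm_nonneg[OF C] and triangle = cstar_algebra.nrm_triangle[OF C]
    and smult = cstar_algebra.nrm_smult[OF C] and mult = cstar_algebra.nrm_mult[OF C]
    and cstar = cstar_algebra.nrm_cstar[OF C]
  note upper = nrm_bounded_product_upper
  have in_A [simp]: "x i \<in> carrier (A i)" if "x \<in> carrier ?P" "i \<in> I" for x i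
    using that by (auto simp: carrier_bounded_product)
  have eqI: "x = y" if "x \<in> extensional I" "y \<in> extensional I" "\<And>i. i \<in> I \<Longrightarrow> x i = y i" for x y :: "'a \<Rightarrow> 'b"
    using that by (rule extensionalityI)
  have ext [simp]: "x \<in> extensional I" if "x \<in> carrier ?P" for x
    using that by (auto simp: carrier_bounded_product PiE_def)
  have memI: "(\<lambda>i\<in>I. f i) \<in> carrier ?P"
    if "\<And>i. i \<in> I \<Longrightarrow> f i \<in> carrier (A i)" "\<And>i. i \<in> I \<Longrightarrow> nrm (A i) (f i) \<le> c" for f c
    using that by (auto simp: carrier_bounded_product)
  have zero_in: "\<zero>\<^bsub>?P\<^esub> \<in> carrier ?P"
    by (auto intro!: memI[of _ 0] simp: cstar_algebra.nrm_zero[OF C])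
  have nrm_add: "nrm (A i) (x i \<oplus>\<^bsub>A i\<^esub> y i) \<le> nrm ?P x + nrm ?P y"
    if "x \<in> carrier ?P" "y \<in> carrier ?P" "i \<in> I" for x y i
    using triangle[of i "x i" "y i"] upper(1)[of x I A i] upper(1)[of y I A i] that by simp
  have nrm_mult: "nrm (A i) (x i \<otimes>\<^bsub>A i\<^esub> y i) \<le> nrm ?P x * nrm ?P y"
    if "x \<in> carrier ?P" "y \<in> carrier ?P" "i \<in> I" for x y i
    using mult[of i "x i" "y i"] mult_mono[OF upper(1)[of x I A i] upper(1)[of y I A i]] that
    by (simp add: nonneg upper(2))
  have nrm_smult_le: "nrm (A i) (c \<odot>\<^bsub>A i\<^esub> x i) \<le> cmod c * nrm ?P x"
    if "x \<in> carrier ?P" "i \<in> I" for x c i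
    using upper(1)[of x I A i] that by (simp add: smult mult_left_mono)
  have nrm_adj: "nrm (A i) (adj (A i) (x i)) \<le> nrm ?P x" if "x \<in> carrier ?P" "i \<in> I" for x i
    using upper(1)[of x I A i] that by (simp add: cstar_algebra.nrm_adj[OF C])
  have add_in: "x \<oplus>\<^bsub>?P\<^esub> y \<in> carrier ?P" if "x \<in> carrier ?P" "y \<in> carrier ?P" for x y
    using that by (auto intro!: memI nrm_add)
  have mult_in: "x \<otimes>\<^bsub>?P\<^esub> y \<in> carrier ?P" if "x \<in> carrier ?P" "y \<in> carrier ?P" for x y
    using that by (auto intro!: memI nrm_mult)
  have smult_in: "c \<odot>\<^bsub>?P\<^esub> x \<in> carrier ?P" if "x \<in> carrier ?P" for c x
    using that by (auto intro!: memI nrm_smult_le)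
  have adj_in: "adj ?P x \<in> carrier ?P" if "x \<in> carrier ?P" for x
    using that by (auto intro!: memI nrm_adj)
  show ?thesis
  proof (rule cstar_algebraI)
    fix x assume x: "x \<in> carrier ?P"
    show "nrm ?P x = 0 \<longleftrightarrow> x = \<zero>\<^bsub>?P\<^esub>"
    proof
      assume "nrm ?P x = 0"
      then have "nrm (A i) (x i) = 0" if "i \<in> I" for i
        using upper(1)[OF x that] nonneg[OF that] x that by (simp add: order_antisym)
      then show "x = \<zero>\<^bsub>?P\<^esub>"
        using x by (auto intro!: eqI simp: cstar_algebra.nrm_eq_0_iff[OF C])
    next
      assume "x = \<zero>\<^bsub>?P\<^esub>"
      then have "nrm ?P x \<le> 0"
        by (intro nrm_bounded_product_least) (auto simp: cstar_algebra.nrm_zero[OF C])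
      then show "nrm ?P x = 0" using upper(2)[OF x] by simp
    qed
    show "nrm ?P (c \<odot>\<^bsub>?P\<^esub> x) = cmod c * nrm ?P x" for c
    proof (rule order_antisym)
      show le: "nrm ?P (c \<odot>\<^bsub>?P\<^esub> x) \<le> cmod c * nrm ?P x" for c
        using x upper(2)[OF x] by (intro nrm_bounded_product_least) (auto intro: nrm_smult_le)
      show "cmod c * nrm ?P x \<le> nrm ?P (c \<odot>\<^bsub>?P\<^esub> x)"
      proof (cases "c = 0")
        case False
        have "nrm ?P x \<le> nrm ?P (c \<odot>\<^bsub>?P\<^esub> x) / cmod c"
        proof (rule nrm_bounded_product_least)
          fix i assume i: "i \<in> I"
          have "cmod c * nrm (A i) (x i) \<le> nrm ?P (c \<odot>\<^bsub>?P\<^esub> x)"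
            using upper(1)[OF smult_in[OF x] i] x i by (simp add: smult)
          then show "nrm (A i) (x i) \<le> nrm ?P (c \<odot>\<^bsub>?P\<^esub> x) / cmod c"
            using False by (simp add: field_simps)
        qed (use upper(2)[OF smult_in[OF x]] in simp)
        then show ?thesis using False by (simp add: field_simps)
      qed (use upper(2)[OF smult_in[OF x]] in simp)
    qed
    show "nrm ?P (adj ?P x \<otimes>\<^bsub>?P\<^esub> x) = (nrm ?P x)\<^sup>2"
    proof (rule order_antisym)
      show "nrm ?P (adj ?P x \<otimes>\<^bsub>?P\<^esub> x) \<le> (nrm ?P x)\<^sup>2"
        using x upper(1)[OF x]
        by (intro nrm_bounded_product_least) (auto simp: cstar nonneg intro!: power_mono)
      let ?s = "nrm ?P (adj ?P x \<otimes>\<^bsub>?P\<^esub> x)"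
      have s: "?s \<ge> 0" using upper(2)[OF mult_in[OF adj_in[OF x] x]] .
      have "nrm ?P x \<le> sqrt ?s"
      proof (rule nrm_bounded_product_least)
        fix i assume i: "i \<in> I"
        show "nrm (A i) (x i) \<le> sqrt ?s"
          using upper(1)[OF mult_in[OF adj_in[OF x] x] i] x i by (intro real_le_rsqrt) (simp add: cstar)
      qed (use s in simp)
      then show "(nrm ?P x)\<^sup>2 \<le> ?s"
        using upper(2)[OF x] s by (metis power_mono real_sqrt_pow2)
    qed
  next
    fix \<sigma> :: "nat \<Rightarrow> _" assume \<sigma>: "\<And>k. \<sigma> k \<in> carrier ?P"
      and Cauchy: "\<And>e. e > 0 \<Longrightarrow>
        \<exists>N. \<forall>i\<ge>N. \<forall>j\<ge>N. nrm ?P (\<sigma> i \<oplus>\<^bsub>?P\<^esub> (-1) \<odot>\<^bsub>?P\<^esub> \<sigma> j) < e"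
    have diff: "nrm (A t) (\<sigma> i t \<oplus>\<^bsub>A t\<^esub> (-1) \<odot>\<^bsub>A t\<^esub> \<sigma> j t) \<le> nrm ?P (\<sigma> i \<oplus>\<^bsub>?P\<^esub> (-1) \<odot>\<^bsub>?P\<^esub> \<sigma> j)"
      if "t \<in> I" for i j t
      using upper(1)[OF add_in[OF \<sigma> smult_in[OF \<sigma>]] that] that by simp
    have "\<exists>l. limitin (cstar_topology (A t)) (\<lambda>k. \<sigma> k t) l sequentially" if t: "t \<in> I" for t
    proof (rule cstar_algebra.Cauchy_imp_limitin[OF C[OF t]])
      show "\<sigma> k t \<in> carrier (A t)" for k
        using \<sigma> t by simp
      fix e :: real assume "e > 0"
      from Cauchy[OF this] obtain N where
        "\<forall>i\<ge>N. \<forall>j\<ge>N. nrm ?P (\<sigma> i \<oplus>\<^bsub>?P\<^esub> (-1) \<odot>\<^bsub>?P\<^esub> \<sigma> j) < e" ..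
      then have "\<forall>i\<ge>N. \<forall>j\<ge>N. nrm (A t) (\<sigma> i t \<oplus>\<^bsub>A t\<^esub> (-1) \<odot>\<^bsub>A t\<^esub> \<sigma> j t) < e"
        using diff[OF t] by (meson le_less_trans)
      then show "\<exists>N. \<forall>i\<ge>N. \<forall>j\<ge>N. nrm (A t) (\<sigma> i t \<oplus>\<^bsub>A t\<^esub> (-1) \<odot>\<^bsub>A t\<^esub> \<sigma> j t) < e" ..
    qed
    then obtain l where l: "\<And>t. t \<in> I \<Longrightarrow> limitin (cstar_topology (A t)) (\<lambda>k. \<sigma> k t) (l t) sequentially"
      by metis
    then have l_in [simp]: "l t \<in> carrier (A t)" if "t \<in> I" for t
      using that by (simp add: cstar_algebra.limitin_iff[OF C])
    \<comment> \<open>uniform convergence: the estimate survives the limit in \<open>j\<close>\<close>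
    have close: "\<exists>N. \<forall>i\<ge>N. \<forall>t\<in>I. nrm (A t) (\<sigma> i t \<oplus>\<^bsub>A t\<^esub> (-1) \<odot>\<^bsub>A t\<^esub> l t) \<le> e" if "e > 0" for e
    proof -
      obtain N where N: "\<And>i j. \<lbrakk>i \<ge> N; j \<ge> N\<rbrakk>
          \<Longrightarrow> nrm ?P (\<sigma> i \<oplus>\<^bsub>?P\<^esub> (-1) \<odot>\<^bsub>?P\<^esub> \<sigma> j) < e"
        using Cauchy[OF \<open>e > 0\<close>] by blast
      have "nrm (A t) (\<sigma> i t \<oplus>\<^bsub>A t\<^esub> (-1) \<odot>\<^bsub>A t\<^esub> l t) \<le> e" if "i \<ge> N" "t \<in> I" for i t
      proof -
        have "(\<lambda>j. nrm (A t) (\<sigma> i t \<oplus>\<^bsub>A t\<^esub> (-1) \<odot>\<^bsub>A t\<^esub> \<sigma> j t))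
            \<longlonglongrightarrow> nrm (A t) (\<sigma> i t \<oplus>\<^bsub>A t\<^esub> (-1) \<odot>\<^bsub>A t\<^esub> l t)"
          using \<sigma> that(2)
          by (intro cstar_algebra.limitin_nrm[OF C] cstar_algebra.limitin_add[OF C]
            cstar_algebra.limitin_const[OF C] cstar_algebra.limitin_smult[OF C] l in_A) auto
        then show ?thesis
          using order_trans[OF diff[OF that(2)] less_imp_le[OF N[OF that(1)]]]
          by (intro LIMSEQ_le_const2[of _ _ e]) auto
      qed
      then show ?thesis by blast
    qed
    define m where "m = (\<lambda>t\<in>I. l t)"
    obtain N where N: "\<And>t. t \<in> I \<Longrightarrow> nrm (A t) (\<sigma> N t \<oplus>\<^bsub>A t\<^esub> (-1) \<odot>\<^bsub>A t\<^esub> l t) \<le> 1"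
      using close[of 1] by auto
    have m_in: "m \<in> carrier ?P"
      unfolding m_def
    proof (rule memI)
      fix t assume t: "t \<in> I"
      interpret A: cstar_algebra "A t" using C[OF t] .
      have "nrm (A t) (l t) \<le> nrm (A t) (\<sigma> N t) + nrm (A t) (\<sigma> N t \<ominus>\<^bsub>A t\<^esub> l t)"
        using A.nrm_minus_ge[of "\<sigma> N t" "l t"] \<sigma> t by simp
      also have "\<dots> \<le> nrm ?P (\<sigma> N) + 1"
        using N[OF t] upper(1)[OF \<sigma> t] \<sigma> t by (intro add_mono) (simp_all add: A.minus_eq_smult)
      finally show "nrm (A t) (l t) \<le> nrm ?P (\<sigma> N) + 1" .
    qed simp
    have "(\<lambda>k. nrm ?P (\<sigma> k \<oplus>\<^bsub>?P\<^esub> (-1) \<odot>\<^bsub>?P\<^esub> m)) \<longlonglongrightarrow> 0"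
    proof (rule LIMSEQ_I)
      fix e :: real assume e: "e > 0"
      then obtain N where N: "\<And>i t. \<lbrakk>i \<ge> N; t \<in> I\<rbrakk>
          \<Longrightarrow> nrm (A t) (\<sigma> i t \<oplus>\<^bsub>A t\<^esub> (-1) \<odot>\<^bsub>A t\<^esub> l t) \<le> e / 2"
        using close[of "e / 2"] by auto
      have "nrm ?P (\<sigma> i \<oplus>\<^bsub>?P\<^esub> (-1) \<odot>\<^bsub>?P\<^esub> m) \<le> e / 2" if "i \<ge> N" for i
        using N[OF that] e by (intro nrm_bounded_product_least) (auto simp: m_def)
      then show "\<exists>N. \<forall>i\<ge>N. norm (nrm ?P (\<sigma> i \<oplus>\<^bsub>?P\<^esub> (-1) \<odot>\<^bsub>?P\<^esub> m) - 0) < e"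
        using e upper(2)[OF add_in[OF \<sigma> smult_in[OF m_in]]] by (intro exI[of _ N]) force
    qed
    then show "\<exists>l\<in>carrier ?P. (\<lambda>k. nrm ?P (\<sigma> k \<oplus>\<^bsub>?P\<^esub> (-1) \<odot>\<^bsub>?P\<^esub> l)) \<longlonglongrightarrow> 0"
      using m_in by blast
  next
    fix x y assume "x \<in> carrier ?P" "y \<in> carrier ?P"
    then show "x \<oplus>\<^bsub>?P\<^esub> y = y \<oplus>\<^bsub>?P\<^esub> x"
      by (auto intro!: restrict_ext simp: cstar_algebra.add_commute[OF C])
  next
    fix x y assume "x \<in> carrier ?P" "y \<in> carrier ?P"
    then show "nrm ?P (x \<oplus>\<^bsub>?P\<^esub> y) \<le> nrm ?P x + nrm ?P y"
      by (intro nrm_bounded_product_least) (auto intro: nrm_add add_nonneg_nonneg upper(2))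
  next
    fix x y assume "x \<in> carrier ?P" "y \<in> carrier ?P"
    then show "nrm ?P (x \<otimes>\<^bsub>?P\<^esub> y) \<le> nrm ?P x * nrm ?P y"
      by (intro nrm_bounded_product_least) (auto intro: nrm_mult mult_nonneg_nonneg upper(2))
  qed (fact zero_in add_in mult_in smult_in adj_in upper(2) |
      (rule eqI; simp add: eqs))+
qed

section \<open>Morphisms and equalizers\<close>

lemma cstar_homI:
  assumes "cstar_algebra A" "cstar_algebra B"
    and "\<And>x. x \<in> carrier A \<Longrightarrow> h x \<in> carrier B"
    and "\<And>x y. \<lbrakk>x \<in> carrier A; y \<in> carrier A\<rbrakk> \<Longrightarrow> h (x \<oplus>\<^bsub>A\<^esub> y) = h x \<oplus>\<^bsub>B\<^esub> h y"
    and "\<And>c x. x \<in> carrier A \<Longrightarrow> h (c \<odot>\<^bsub>A\<^esub> x) = c \<odot>\<^bsub>B\<^esub> h x"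
    and "\<And>x y. \<lbrakk>x \<in> carrier A; y \<in> carrier A\<rbrakk> \<Longrightarrow> h (x \<otimes>\<^bsub>A\<^esub> y) = h x \<otimes>\<^bsub>B\<^esub> h y"
    and "\<And>x. x \<in> carrier A \<Longrightarrow> h (adj A x) = adj B (h x)"
  shows "cstar_hom A B h"
  using assms by (intro cstar_hom.intro cstar_hom_axioms.intro)

lemma cstar_hom_compose:
  assumes "cstar_hom A B g" "cstar_hom B C h"
  shows "cstar_hom A C (\<lambda>x. h (g x))"
proof -
  interpret g: cstar_hom A B g by fact
  interpret h: cstar_hom B C h by fact
  show ?thesis
    by (intro cstar_homI g.A.cstar_algebra_axioms h.B.cstar_algebra_axioms)
      (simp_all add: g.hom_closed h.hom_closed g.hom_add h.hom_add g.hom_smult h.hom_smult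
        g.hom_mult h.hom_mult g.hom_adj h.hom_adj)
qed

lemma cstar_hom_zero:
  assumes "cstar_algebra A" "cstar_algebra B"
  shows "cstar_hom A B (\<lambda>_. \<zero>\<^bsub>B\<^esub>)"
proof -
  interpret B: cstar_algebra B by fact
  have "c \<odot>\<^bsub>B\<^esub> \<zero>\<^bsub>B\<^esub> = \<zero>\<^bsub>B\<^esub>" for c
    using B.smult_r_null[of c] by simp
  moreover have "\<zero>\<^bsub>B\<^esub> \<otimes>\<^bsub>B\<^esub> \<zero>\<^bsub>B\<^esub> = \<zero>\<^bsub>B\<^esub>"
    using B.smult_mult_left[of "\<zero>\<^bsub>B\<^esub>" "\<zero>\<^bsub>B\<^esub>" 0] by simp
  moreover have "adj B \<zero>\<^bsub>B\<^esub> = \<zero>\<^bsub>B\<^esub>"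
    using B.adj_smult[of "\<zero>\<^bsub>B\<^esub>" 0] by simp
  ultimately show ?thesis
    by (intro cstar_homI assms) simp_all
qed

lemma cstar_hom_id:
  assumes "cstar_algebra A"
  shows "cstar_hom A A (\<lambda>x. x)"
  using assms by (intro cstar_homI) simp_all

lemma cstar_hom_restrict_domain:
  assumes "cstar_hom A B h" "cstar_algebra (A\<lparr>carrier := S\<rparr>)" "S \<subseteq> carrier A"
  shows "cstar_hom (A\<lparr>carrier := S\<rparr>) B h"
proof -
  interpret cstar_hom A B h by fact
  have [simp]: "x \<in> S \<Longrightarrow> x \<in> carrier A" for x using assms by blast
  show ?thesis
    by (intro cstar_homI assms B.cstar_algebra_axioms)
      (simp_all add: hom_closed hom_add hom_mult hom_smult hom_adj)
qed

lemma cstar_hom_restrict_codomain: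
  assumes "cstar_hom A B h" "cstar_algebra (B\<lparr>carrier := S\<rparr>)" "\<And>x. x \<in> carrier A \<Longrightarrow> h x \<in> S"
  shows "cstar_hom A (B\<lparr>carrier := S\<rparr>) h"
proof -
  interpret cstar_hom A B h by fact
  show ?thesis
    by (intro cstar_homI assms A.cstar_algebra_axioms)
      (simp_all add: assms hom_add hom_mult hom_smult hom_adj)
qed

text \<open>All algebras of this theory that are cut out by equations are equalizers of families of morphisms,
  whose completeness rests on the automatic continuity of morphisms.\<close>

lemma cstar_algebra_equalizer:
  assumes "cstar_algebra A"
    and g: "\<And>k. k \<in> K \<Longrightarrow> cstar_hom A (B k) (g k)"
    and h: "\<And>k. k \<in> K \<Longrightarrow> cstar_hom A (B k) (h k)"
  shows "cstar_algebra (A\<lparr>carrier := {x \<in> carrier A. \<forall>k\<in>K. g k x = h k x}\<rparr>)"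
proof -
  interpret A: cstar_algebra A by fact
  note hom = cstar_hom.hom_zero cstar_hom.hom_add cstar_hom.hom_smult cstar_hom.hom_mult
    cstar_hom.hom_adj
  note [simp] = hom[OF g] hom[OF h]
  show ?thesis
  proof (rule cstar_algebra_closed_subalgebra[OF assms(1)])
    fix \<sigma> :: "nat \<Rightarrow> _" and l
    assume "\<And>k. \<sigma> k \<in> carrier (A\<lparr>carrier := {x \<in> carrier A. \<forall>k\<in>K. g k x = h k x}\<rparr>)"
      and lim: "limitin (cstar_topology A) \<sigma> l sequentially"
    then have eq: "g k (\<sigma> i) = h k (\<sigma> i)" if "k \<in> K" for k i
      using that by simp
    have "g k l = h k l" if "k \<in> K" for k
    proof -
      interpret g: cstar_hom A "B k" "g k" using g[OF that] .
      interpret h: cstar_hom A "B k" "h k" using h[OF that] .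
      show ?thesis
        using g.limitin_hom[OF lim] h.limitin_hom[OF lim]
        by (intro g.B.limitin_unique[of "\<lambda>i. g k (\<sigma> i)" _ sequentially]) (simp_all add: eq that)
    qed
    then show "l \<in> carrier (A\<lparr>carrier := {x \<in> carrier A. \<forall>k\<in>K. g k x = h k x}\<rparr>)"
      using lim by (simp add: A.limitin_iff)
  qed auto
qed

section \<open>Direct sums\<close>

lemma cstar_Sum_eq_bounded_product:
  assumes "finite I"
  shows "cstar_Sum I A = bounded_product I A"
  using assms by (simp add: bounded_product_def cstar_Sum_def cSup_eq_Max)

lemma cstar_algebra_Sum:
  "\<lbrakk>finite I; \<And>i. i \<in> I \<Longrightarrow> cstar_algebra (A i)\<rbrakk> \<Longrightarrow> cstar_algebra (cstar_Sum I A)"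
  by (simp add: cstar_Sum_eq_bounded_product cstar_algebra_bounded_product)

lemma cstar_hom_component:
  assumes "finite I" "\<And>i. i \<in> I \<Longrightarrow> cstar_algebra (A i)" "i \<in> I"
  shows "cstar_hom (cstar_Sum I A) (A i) (\<lambda>x. x i)"
  using assms by (intro cstar_homI cstar_algebra_Sum) (auto simp: cstar_Sum_def)

lemma cstar_hom_tuple:
  assumes "finite I" "cstar_algebra C" "\<And>i. i \<in> I \<Longrightarrow> cstar_hom C (A i) (f i)"
  shows "cstar_hom C (cstar_Sum I A) (\<lambda>x. \<lambda>i\<in>I. f i x)"
proof -
  have A: "cstar_algebra (A i)" if "i \<in> I" for i
    using assms(3)[OF that] by (simp add: cstar_hom_def)
  note hom = cstar_hom.hom_closed cstar_hom.hom_add cstar_hom.hom_smult cstar_hom.hom_mult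
    cstar_hom.hom_adj
  note [simp] = hom[OF assms(3)]
  show ?thesis
    using assms A by (intro cstar_homI cstar_algebra_Sum) (auto simp: cstar_Sum_def intro!: restrict_ext)
qed

lemma cstar_sum_ops [simp]:
  "carrier (A \<oplus>\<^sub>C B) = carrier A \<times> carrier B"
  "\<zero>\<^bsub>A \<oplus>\<^sub>C B\<^esub> = (\<zero>\<^bsub>A\<^esub>, \<zero>\<^bsub>B\<^esub>)"
  "x \<oplus>\<^bsub>A \<oplus>\<^sub>C B\<^esub> y = (fst x \<oplus>\<^bsub>A\<^esub> fst y, snd x \<oplus>\<^bsub>B\<^esub> snd y)"
  "x \<otimes>\<^bsub>A \<oplus>\<^sub>C B\<^esub> y = (fst x \<otimes>\<^bsub>A\<^esub> fst y, snd x \<otimes>\<^bsub>B\<^esub> snd y)"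
  "c \<odot>\<^bsub>A \<oplus>\<^sub>C B\<^esub> x = (c \<odot>\<^bsub>A\<^esub> fst x, c \<odot>\<^bsub>B\<^esub> snd x)"
  "adj (A \<oplus>\<^sub>C B) x = (adj A (fst x), adj B (snd x))"
  "nrm (A \<oplus>\<^sub>C B) x = max (nrm A (fst x)) (nrm B (snd x))"
  by (simp_all add: cstar_sum_def split_beta)

text \<open>The two summands may have different types, so this is no instance of the product of a family.\<close>

lemma cstar_algebra_sum:
  assumes "cstar_algebra A" "cstar_algebra B"
  shows "cstar_algebra (A \<oplus>\<^sub>C B)"
proof -
  interpret A: cstar_algebra A by fact
  interpret B: cstar_algebra B by fact
  show ?thesis
  proof (rule cstar_algebraI)
    fix x assume x: "x \<in> carrier (A \<oplus>\<^sub>C B)"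
    obtain a b where ab: "x = (a, b)" "a \<in> carrier A" "b \<in> carrier B" using x by auto
    have na: "nrm A a \<ge> 0" and nb: "nrm B b \<ge> 0" using ab A.nrm_nonneg B.nrm_nonneg by auto
    show "nrm (A \<oplus>\<^sub>C B) (adj (A \<oplus>\<^sub>C B) x \<otimes>\<^bsub>A \<oplus>\<^sub>C B\<^esub> x) = (nrm (A \<oplus>\<^sub>C B) x)\<^sup>2"
      using ab na nb by (auto simp: A.nrm_cstar B.nrm_cstar max_def)
    show "nrm (A \<oplus>\<^sub>C B) x = 0 \<longleftrightarrow> x = \<zero>\<^bsub>A \<oplus>\<^sub>C B\<^esub>"
      using ab na nb A.nrm_eq_0_iff[of a] B.nrm_eq_0_iff[of b] by (auto simp: max_def)
    show "nrm (A \<oplus>\<^sub>C B) (c \<odot>\<^bsub>A \<oplus>\<^sub>C B\<^esub> x) = cmod c * nrm (A \<oplus>\<^sub>C B) x" for c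
      using ab by (simp add: A.nrm_smult B.nrm_smult max_mult_distrib_left)
  next
    fix x y assume xy: "x \<in> carrier (A \<oplus>\<^sub>C B)" "y \<in> carrier (A \<oplus>\<^sub>C B)"
    obtain a b a' b' where ab: "x = (a, b)" "a \<in> carrier A" "b \<in> carrier B"
      "y = (a', b')" "a' \<in> carrier A" "b' \<in> carrier B" using xy by auto
    show "nrm (A \<oplus>\<^sub>C B) (x \<oplus>\<^bsub>A \<oplus>\<^sub>C B\<^esub> y) \<le> nrm (A \<oplus>\<^sub>C B) x + nrm (A \<oplus>\<^sub>C B) y"
      using ab A.nrm_triangle[of a a'] B.nrm_triangle[of b b'] by (simp add: max_def)
    have "nrm A (a \<otimes>\<^bsub>A\<^esub> a') \<le> max (nrm A a) (nrm B b) * max (nrm A a') (nrm B b')"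
      using ab A.nrm_nonneg
      by (intro order_trans[OF A.nrm_mult] mult_mono) (auto simp: le_max_iff_disj)
    moreover have "nrm B (b \<otimes>\<^bsub>B\<^esub> b') \<le> max (nrm A a) (nrm B b) * max (nrm A a') (nrm B b')"
      using ab B.nrm_nonneg
      by (intro order_trans[OF B.nrm_mult] mult_mono) (auto simp: le_max_iff_disj)
    ultimately show "nrm (A \<oplus>\<^sub>C B) (x \<otimes>\<^bsub>A \<oplus>\<^sub>C B\<^esub> y) \<le> nrm (A \<oplus>\<^sub>C B) x * nrm (A \<oplus>\<^sub>C B) y"
      using ab by simp
    show "x \<oplus>\<^bsub>A \<oplus>\<^sub>C B\<^esub> y = y \<oplus>\<^bsub>A \<oplus>\<^sub>C B\<^esub> x"
      using ab by (simp add: A.add_commute[of a] B.add_commute[of b])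
  next
    fix \<sigma> :: "nat \<Rightarrow> _"
    assume "\<And>k. \<sigma> k \<in> carrier (A \<oplus>\<^sub>C B)"
      and Cauchy: "\<And>e. e > 0 \<Longrightarrow> \<exists>N. \<forall>i\<ge>N. \<forall>j\<ge>N.
        nrm (A \<oplus>\<^sub>C B) (\<sigma> i \<oplus>\<^bsub>A \<oplus>\<^sub>C B\<^esub> (-1) \<odot>\<^bsub>A \<oplus>\<^sub>C B\<^esub> \<sigma> j) < e"
    then have \<sigma>: "fst (\<sigma> k) \<in> carrier A" "snd (\<sigma> k) \<in> carrier B" for k
      by (metis cstar_sum_ops(1) mem_Times_iff)+
    have "\<exists>N. \<forall>i\<ge>N. \<forall>j\<ge>N. nrm A (fst (\<sigma> i) \<oplus>\<^bsub>A\<^esub> (-1) \<odot>\<^bsub>A\<^esub> fst (\<sigma> j)) < e" if "e > 0" for e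
      using Cauchy[OF that] by (simp only: cstar_sum_ops max_less_iff_conj fst_conv snd_conv) meson
    then have "\<exists>l. limitin (cstar_topology A) (\<lambda>k. fst (\<sigma> k)) l sequentially"
      using \<sigma> by (intro A.Cauchy_imp_limitin)
    then obtain l where l: "l \<in> carrier A" "(\<lambda>k. nrm A (fst (\<sigma> k) \<oplus>\<^bsub>A\<^esub> (-1) \<odot>\<^bsub>A\<^esub> l)) \<longlonglongrightarrow> 0"
      by (auto simp: A.limitin_iff_smult)
    have "\<exists>N. \<forall>i\<ge>N. \<forall>j\<ge>N. nrm B (snd (\<sigma> i) \<oplus>\<^bsub>B\<^esub> (-1) \<odot>\<^bsub>B\<^esub> snd (\<sigma> j)) < e" if "e > 0" for e
      using Cauchy[OF that] by (simp only: cstar_sum_ops max_less_iff_conj fst_conv snd_conv) meson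
    then have "\<exists>m. limitin (cstar_topology B) (\<lambda>k. snd (\<sigma> k)) m sequentially"
      using \<sigma> by (intro B.Cauchy_imp_limitin)
    then obtain m where m: "m \<in> carrier B" "(\<lambda>k. nrm B (snd (\<sigma> k) \<oplus>\<^bsub>B\<^esub> (-1) \<odot>\<^bsub>B\<^esub> m)) \<longlonglongrightarrow> 0"
      by (auto simp: B.limitin_iff_smult)
    show "\<exists>l\<in>carrier (A \<oplus>\<^sub>C B).
        (\<lambda>k. nrm (A \<oplus>\<^sub>C B) (\<sigma> k \<oplus>\<^bsub>A \<oplus>\<^sub>C B\<^esub> (-1) \<odot>\<^bsub>A \<oplus>\<^sub>C B\<^esub> l)) \<longlonglongrightarrow> 0"
      using l m tendsto_max[OF l(2) m(2)] by (intro bexI[of _ "(l, m)"]) auto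
  qed (auto simp: A.equational_laws B.equational_laws A.nrm_nonneg le_max_iff_disj)
qed

lemma cstar_hom_fst: "\<lbrakk>cstar_algebra A; cstar_algebra B\<rbrakk> \<Longrightarrow> cstar_hom (A \<oplus>\<^sub>C B) A fst"
  by (intro cstar_homI cstar_algebra_sum) auto

lemma cstar_hom_snd: "\<lbrakk>cstar_algebra A; cstar_algebra B\<rbrakk> \<Longrightarrow> cstar_hom (A \<oplus>\<^sub>C B) B snd"
  by (intro cstar_homI cstar_algebra_sum) auto

lemma cstar_hom_pair:
  assumes "cstar_hom C A f" "cstar_hom C B g"
  shows "cstar_hom C (A \<oplus>\<^sub>C B) (\<lambda>x. (f x, g x))"
proof -
  interpret f: cstar_hom C A f by fact
  interpret g: cstar_hom C B g by fact
  show ?thesis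
    by (intro cstar_homI cstar_algebra_sum f.A.cstar_algebra_axioms f.B.cstar_algebra_axioms
        g.B.cstar_algebra_axioms)
      (auto simp: f.hom_closed g.hom_closed f.hom_add g.hom_add f.hom_smult g.hom_smult
        f.hom_mult g.hom_mult f.hom_adj g.hom_adj)
qed

section \<open>Paths\<close>

lemma path_algebra_ops [simp]:
  "\<zero>\<^bsub>path_algebra A\<^esub> = (\<lambda>t\<in>{0..1}. \<zero>\<^bsub>A\<^esub>)"
  "f \<oplus>\<^bsub>path_algebra A\<^esub> g = (\<lambda>t\<in>{0..1}. f t \<oplus>\<^bsub>A\<^esub> g t)"
  "f \<otimes>\<^bsub>path_algebra A\<^esub> g = (\<lambda>t\<in>{0..1}. f t \<otimes>\<^bsub>A\<^esub> g t)"
  "c \<odot>\<^bsub>path_algebra A\<^esub> f = (\<lambda>t\<in>{0..1}. c \<odot>\<^bsub>A\<^esub> f t)"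
  "adj (path_algebra A) f = (\<lambda>t\<in>{0..1}. adj A (f t))"
  by (simp_all add: path_algebra_def)

text \<open>Translates the limits in terms of which continuous maps between abstract topologies are characterised
  into limits along the usual filters on the real line.\<close>

lemma atin_top_of_set:
  fixes S :: "real set"
  assumes "t \<in> S"
  shows "atin (top_of_set S) t = at t within S"
  using assms unfolding filter_eq_iff
  by (auto simp: eventually_atin eventually_at_topological openin_open)

lemma carrier_path_algebra:
  "f \<in> carrier (path_algebra A) \<longleftrightarrow>
     f \<in> extensional {0..1} \<and> (\<forall>t\<in>{0..1}. limitin (cstar_topology A) f (f t) (at t within {0..1}))"
  by (auto simp: path_algebra_def continuous_map_atin atin_top_of_set)

lemma limitin_restrict_interval [simp]:
  fixes t :: real
  shows "limitin X (restrict f {0..1}) l (at t within {0..1}) \<longleftrightarrow> limitin X f l (at t within {0..1})"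
proof -
  have ev: "\<forall>\<^sub>F s in at t within {0..1}. restrict f {0..1} s = f s"
    "\<forall>\<^sub>F s in at t within {0..1}. f s = restrict f {0..1} s"
    by (auto simp: eventually_at_topological)
  show ?thesis
    using limitin_transform_eventually[OF ev(1)] limitin_transform_eventually[OF ev(2)] by blast
qed

text \<open>Paths have compact domain, so they are bounded, and a uniform limit of paths is a path: the path
  algebra is a closed subalgebra of the \<open>\<ell>\<^sup>\<infinity>\<close>-product.\<close>

lemma cstar_algebra_path_algebra:
  assumes "cstar_algebra A"
  shows "cstar_algebra (path_algebra A)"
proof -
  interpret A: cstar_algebra A by fact
  let ?P = "bounded_product {0..1::real} (\<lambda>_. A)"
  have in_A: "f t \<in> carrier A" if "f \<in> carrier (path_algebra A)" "t \<in> {0..1}" for f t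
    using that by (simp add: carrier_path_algebra A.limitin_iff)
  have sub: "carrier (path_algebra A) \<subseteq> carrier ?P"
  proof
    fix f assume f: "f \<in> carrier (path_algebra A)"
    then have "continuous_on {0..1} (\<lambda>t. nrm A (f t))"
      by (auto simp: continuous_on_def carrier_path_algebra intro: A.limitin_nrm)
    then have "bdd_above ((\<lambda>t. nrm A (f t)) ` {0..1})"
      by (intro bounded_imp_bdd_above compact_imp_bounded compact_continuous_image) auto
    then show "f \<in> carrier ?P"
      using f in_A[OF f] by (auto simp: carrier_bounded_product carrier_path_algebra bdd_above_def PiE_iff)
  qed
  show ?thesis
  proof (rule cstar_algebra_closed_subalgebra[of ?P])
    show "cstar_algebra ?P"
      by (intro cstar_algebra_bounded_product assms)
    then interpret P: cstar_algebra ?P .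
    fix \<sigma> :: "nat \<Rightarrow> _" and l
    assume \<sigma>: "\<And>k. \<sigma> k \<in> carrier (path_algebra A)"
      and "limitin (cstar_topology ?P) \<sigma> l sequentially"
    then have l: "l \<in> carrier ?P" and conv: "(\<lambda>k. nrm ?P (\<sigma> k \<oplus>\<^bsub>?P\<^esub> (-1) \<odot>\<^bsub>?P\<^esub> l)) \<longlonglongrightarrow> 0"
      by (auto simp: P.limitin_iff_smult)
    have l_in: "l t \<in> carrier A" if "t \<in> {0..1}" for t
      using l that by (auto simp: carrier_bounded_product)
    \<comment> \<open>the \<open>e / 3\<close> argument with a single term of the sequence\<close>
    have "limitin (cstar_topology A) l (l t) (at t within {0..1})" if t: "t \<in> {0..1}" for t
    proof -
      have in01: "\<forall>\<^sub>F s in at t within {0..1}. s \<in> {0..1}"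
        by (simp add: eventually_at_topological) auto
      have "\<forall>\<^sub>F s in at t within {0..1}. nrm A (l s \<ominus>\<^bsub>A\<^esub> l t) < e" if "e > 0" for e
      proof -
        have "\<forall>\<^sub>F k in sequentially. nrm ?P (\<sigma> k \<oplus>\<^bsub>?P\<^esub> (-1) \<odot>\<^bsub>?P\<^esub> l) < e / 3"
          by (rule order_tendstoD(2)[OF conv]) (use that in simp)
        then obtain k where k: "nrm ?P (\<sigma> k \<oplus>\<^bsub>?P\<^esub> (-1) \<odot>\<^bsub>?P\<^esub> l) < e / 3"
          using eventually_happens'[OF sequentially_bot] by blast
        have close: "nrm A (\<sigma> k s \<ominus>\<^bsub>A\<^esub> l s) < e / 3" if "s \<in> {0..1}" for s
        proof -
          have "\<sigma> k \<oplus>\<^bsub>?P\<^esub> (-1) \<odot>\<^bsub>?P\<^esub> l \<in> carrier ?P"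
            using \<sigma> sub l by (intro P.add_in_carrier P.smult_in_carrier) auto
          from nrm_bounded_product_upper(1)[OF this that] k
          show ?thesis
            using that in_A[OF \<sigma> that] l_in[OF that] by (simp add: A.minus_eq_smult)
        qed
        have "((\<lambda>s. nrm A (\<sigma> k s \<ominus>\<^bsub>A\<^esub> \<sigma> k t)) \<longlongrightarrow> 0) (at t within {0..1})"
          using \<sigma>[of k] t by (simp add: carrier_path_algebra A.limitin_iff)
        then have "\<forall>\<^sub>F s in at t within {0..1}. nrm A (\<sigma> k s \<ominus>\<^bsub>A\<^esub> \<sigma> k t) < e / 3"
          using that by (intro order_tendstoD(2)) auto
        with in01 show ?thesis
        proof eventually_elim
          case (elim s)
          note mem = in_A[OF \<sigma>[of k] t] in_A[OF \<sigma>[of k] elim(1)] l_in[OF t] l_in[OF elim(1)]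
          have "nrm A (l s \<ominus>\<^bsub>A\<^esub> l t) \<le> nrm A (l s \<ominus>\<^bsub>A\<^esub> \<sigma> k s)
              + (nrm A (\<sigma> k s \<ominus>\<^bsub>A\<^esub> \<sigma> k t) + nrm A (\<sigma> k t \<ominus>\<^bsub>A\<^esub> l t))"
            using mem A.minus_add_minus[of "l s" "\<sigma> k s" "l t"] A.minus_add_minus[of "\<sigma> k s" "\<sigma> k t" "l t"]
              A.nrm_triangle[of "l s \<ominus>\<^bsub>A\<^esub> \<sigma> k s" "\<sigma> k s \<ominus>\<^bsub>A\<^esub> l t"]
              A.nrm_triangle[of "\<sigma> k s \<ominus>\<^bsub>A\<^esub> \<sigma> k t" "\<sigma> k t \<ominus>\<^bsub>A\<^esub> l t"] by simp
          then show ?case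
            using close[OF t] close[OF elim(1)] elim(2) A.nrm_minus_commute[of "l s" "\<sigma> k s"] mem by simp
        qed
      qed
      then have "((\<lambda>s. nrm A (l s \<ominus>\<^bsub>A\<^esub> l t)) \<longlongrightarrow> 0) (at t within {0..1})"
        using in01 l_in t A.nrm_nonneg
        by (intro order_tendstoI) (auto elim!: eventually_mono intro: less_le_trans)
      then show ?thesis
        using in01 l_in t by (auto simp: A.limitin_iff elim: eventually_mono)
    qed
    then show "l \<in> carrier (path_algebra A)"
      using l by (simp add: carrier_path_algebra carrier_bounded_product PiE_iff)
  next
    fix f assume "f \<in> carrier (path_algebra A)"
    then have "bdd_above ((\<lambda>t. nrm A (f t)) ` {0..1})" "0 \<le> nrm A (f 0)"
      using sub in_A[of f 0] A.nrm_nonneg by (auto simp: bounded_product_def)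
    then have "0 \<le> (SUP t\<in>{0..1}. nrm A (f t))"
      by (intro order_trans[OF _ cSUP_upper[of 0]]) auto
    with \<open>bdd_above _\<close> show "nrm (path_algebra A) f = nrm ?P f"
      by (simp add: path_algebra_def bounded_product_def cSup_insert sup_max)
  qed (use sub in \<open>auto simp: carrier_path_algebra
      intro: A.limitin_const A.limitin_add A.limitin_mult A.limitin_smult A.limitin_adj\<close>)
qed

lemma cstar_hom_eval:
  assumes "cstar_algebra A" "t \<in> {0..1}"
  shows "cstar_hom (path_algebra A) A (\<lambda>f. f t)"
proof -
  interpret A: cstar_algebra A by fact
  show ?thesis
    using assms
    by (intro cstar_homI cstar_algebra_path_algebra) (auto simp: carrier_path_algebra A.limitin_iff)
qed

text \<open>Paths in a telescope are constrained at the end point \<open>1\<close>, paths in a cone at \<open>0\<close>.\<close>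

definition reverse :: "(real \<Rightarrow> 'a) \<Rightarrow> real \<Rightarrow> 'a" where
  "reverse f = (\<lambda>t\<in>{0..1}. f (1 - t))"

lemma reverse_reverse: "f \<in> extensional {0..1} \<Longrightarrow> reverse (reverse f) = f"
  by (auto simp: reverse_def intro: extensionalityI)

lemma reverse_ends [simp]: "reverse f 0 = f 1" "reverse f 1 = f 0"
  by (simp_all add: reverse_def)

lemma reverse_in_path_algebra:
  assumes "f \<in> carrier (path_algebra A)"
  shows "reverse f \<in> carrier (path_algebra A)"
proof -
  have "continuous_map (top_of_set {0..1}) (top_of_set {0..1}) (\<lambda>t::real. 1 - t)"
    by (auto intro!: continuous_intros)
  then have "continuous_map (top_of_set {0..1}) (cstar_topology A) (f \<circ> (\<lambda>t. 1 - t))"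
    using assms by (intro continuous_map_compose) (auto simp: path_algebra_def)
  then have "continuous_map (top_of_set {0..1}) (cstar_topology A) (reverse f)"
    by (rule continuous_map_eq) (simp add: reverse_def)
  then show ?thesis
    by (simp add: path_algebra_def reverse_def)
qed

lemma cstar_hom_reverse:
  assumes "cstar_algebra A"
  shows "cstar_hom (path_algebra A) (path_algebra A) reverse"
  using assms
  by (intro cstar_homI cstar_algebra_path_algebra reverse_in_path_algebra)
    (auto simp: reverse_def intro!: restrict_ext)

lemma cstar_isomorphicI:
  assumes "cstar_hom A B h"
    and "\<And>x. x \<in> carrier A \<Longrightarrow> g (h x) = x"
    and "\<And>y. y \<in> carrier B \<Longrightarrow> g y \<in> carrier A" "\<And>y. y \<in> carrier B \<Longrightarrow> h (g y) = y"
  shows "A \<simeq>\<^sub>C B"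
proof -
  interpret cstar_hom A B h by fact
  have "bij_betw h (carrier A) (carrier B)"
    using assms(2-4) hom_closed by (intro bij_betw_byWitness[of _ g]) auto
  then show ?thesis
    using assms(1) by (auto simp: cstar_isomorphic_def)
qed

section \<open>Cones and mapping cylinders\<close>

lemma carrier_cstar_cone:
  "carrier (cstar_cone A) = {f \<in> carrier (path_algebra A). f 0 = \<zero>\<^bsub>A\<^esub>}"
  by (simp add: cstar_cone_def)

text \<open>Evaluation at \<open>0\<close> is equalized with the zero morphism.\<close>

lemma cstar_algebra_cone:
  assumes "cstar_algebra A"
  shows "cstar_algebra (cstar_cone A)"
  using cstar_algebra_equalizer[OF cstar_algebra_path_algebra[OF assms], of "{()}" "\<lambda>_. A"
      "\<lambda>_ f. f 0" "\<lambda>_ _. \<zero>\<^bsub>A\<^esub>"]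
    cstar_hom_eval[OF assms, of 0] cstar_hom_zero[OF cstar_algebra_path_algebra[OF assms] assms]
  by (simp add: cstar_cone_def)

lemma Cyl_eq:
  "Cyl A B \<alpha> = (A \<oplus>\<^sub>C path_algebra B)\<lparr>carrier :=
     {p \<in> carrier (A \<oplus>\<^sub>C path_algebra B). snd p 1 = \<alpha> (fst p)}\<rparr>"
  unfolding Cyl_def
  by (rule arg_cong[where f = "\<lambda>S. (A \<oplus>\<^sub>C path_algebra B)\<lparr>carrier := S\<rparr>"]) auto

lemma cstar_algebra_Cyl:
  assumes "cstar_hom A B \<alpha>"
  shows "cstar_algebra (Cyl A B \<alpha>)"
proof -
  interpret cstar_hom A B \<alpha> by fact
  note alg = A.cstar_algebra_axioms B.cstar_algebra_axioms
    cstar_algebra_path_algebra[OF B.cstar_algebra_axioms]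
  have "cstar_algebra ((A \<oplus>\<^sub>C path_algebra B)\<lparr>carrier :=
      {p \<in> carrier (A \<oplus>\<^sub>C path_algebra B). \<forall>k\<in>{()}. snd p 1 = \<alpha> (fst p)}\<rparr>)"
    using alg
    by (intro cstar_algebra_equalizer[where B = "\<lambda>_. B"] cstar_algebra_sum
      cstar_hom_compose[OF cstar_hom_fst assms] cstar_hom_compose[OF cstar_hom_snd cstar_hom_eval]) auto
  then show ?thesis
    by (simp add: Cyl_eq)
qed

section \<open>Telescopes of exact sequences\<close>

locale cstar_exact_sequence =
  fixes A :: "nat \<Rightarrow> 'a cstar" and \<alpha> :: "nat \<Rightarrow> 'a \<Rightarrow> 'a" and n :: nat
  assumes algebra: "i \<in> {1..n+1} \<Longrightarrow> cstar_algebra (A i)"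
    and hom: "k \<in> {1..n} \<Longrightarrow> cstar_hom (A k) (A (k+1)) (\<alpha> k)"
    and exact: "k \<in> {1..n-1} \<Longrightarrow>
      a_kernel (A (k+1)) (A (k+2)) (\<alpha> (k+1)) = \<alpha> k ` carrier (A k)"
begin

lemma path: "i \<in> {1..n+1} \<Longrightarrow> cstar_algebra (path_algebra (A i))"
  by (intro cstar_algebra_path_algebra algebra)

lemma cstar_hom_iter_comp:
  "k \<le> n \<Longrightarrow> cstar_hom (A 1) (A (k+1)) (iter_comp \<alpha> k)"
proof (induction k)
  case 0
  then show ?case
    using cstar_hom_id[OF algebra[of 1]] by (simp add: id_def)
next
  case (Suc k)
  then show ?case
    using cstar_hom_compose[of "A 1" "A (k+1)" "iter_comp \<alpha> k" "A (k+2)" "\<alpha> (k+1)"] hom[of "k+1"]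
    by (simp add: comp_def)
qed

text \<open>The inclusion of the image in the kernel makes two consecutive morphisms compose to zero.\<close>

lemma iter_comp_eq_zero:
  assumes "2 \<le> k" "k \<le> n" "a \<in> carrier (A 1)"
  shows "iter_comp \<alpha> k a = \<zero>\<^bsub>A (k+1)\<^esub>"
proof -
  obtain m where k: "k = Suc (Suc m)" using le_Suc_ex[OF assms(1)] by auto
  have "iter_comp \<alpha> m a \<in> carrier (A (m+1))"
    using cstar_hom.hom_closed[OF cstar_hom_iter_comp[of m] assms(3)] assms(2) k by simp
  then have "\<alpha> (m+1) (iter_comp \<alpha> m a) \<in> a_kernel (A (m+2)) (A (m+3)) (\<alpha> (m+2))"
    using exact[of "m+1"] assms(2) k by (simp add: numeral_3_eq_3)
  then show ?thesis
    by (simp add: a_kernel_def' k numeral_3_eq_3)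
qed

text \<open>The telescope is the equalizer, in its ambient direct sum, of the evaluations of the paths at \<open>1\<close> and
  the composites applied to the base point.\<close>

abbreviation ambient :: "nat \<Rightarrow> ('a \<times> (nat \<Rightarrow> real \<Rightarrow> 'a)) cstar" where
  "ambient j \<equiv> A 1 \<oplus>\<^sub>C cstar_Sum {2..j+1} (\<lambda>i. path_algebra (A i))"

lemma cstar_algebra_ambient: "j \<le> n \<Longrightarrow> cstar_algebra (ambient j)"
  by (intro cstar_algebra_sum cstar_algebra_Sum algebra path) auto

lemma cstar_hom_ambient_base: "j \<le> n \<Longrightarrow> cstar_hom (ambient j) (A 1) fst"
  by (intro cstar_hom_fst cstar_algebra_Sum algebra path) auto

lemma cstar_hom_ambient_path:
  assumes "j \<le> n" "i \<in> {2..j+1}"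
  shows "cstar_hom (ambient j) (path_algebra (A i)) (\<lambda>p. snd p i)"
  using assms
  by (intro cstar_hom_compose[OF cstar_hom_snd cstar_hom_component] cstar_algebra_Sum algebra path) auto

lemma telescope_eq:
  "telescope A \<alpha> j = (ambient j)\<lparr>carrier :=
     {p \<in> carrier (ambient j). \<forall>k\<in>{1..j}. snd p (k+1) 1 = iter_comp \<alpha> k (fst p)}\<rparr>"
  unfolding telescope_def
  by (rule arg_cong[where f = "\<lambda>S. (ambient j)\<lparr>carrier := S\<rparr>"]) auto

lemma cstar_algebra_telescope:
  assumes "j \<le> n"
  shows "cstar_algebra (telescope A \<alpha> j)"
  unfolding telescope_eq
proof (rule cstar_algebra_equalizer[where B = "\<lambda>k. A (k+1)"])
  show "cstar_algebra (ambient j)" using assms by (rule cstar_algebra_ambient)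
  fix k assume k: "k \<in> {1..j}"
  show "cstar_hom (ambient j) (A (k+1)) (\<lambda>p. snd p (k+1) 1)"
    using k assms by (intro cstar_hom_compose[OF cstar_hom_ambient_path cstar_hom_eval] algebra) auto
  show "cstar_hom (ambient j) (A (k+1)) (\<lambda>p. iter_comp \<alpha> k (fst p))"
    using k assms by (intro cstar_hom_compose[OF cstar_hom_ambient_base cstar_hom_iter_comp]) auto
qed

text \<open>The decisive consequence of exactness: from the third algebra on, the end point conditions no longer
  involve the base point \<open>a\<close>, so the paths in question are independent of everything else.\<close>

lemma carrier_telescope:
  assumes "1 \<le> j" "j \<le> n"
  shows "p \<in> carrier (telescope A \<alpha> j) \<longleftrightarrow>
     fst p \<in> carrier (A 1) \<and> snd p \<in> (\<Pi>\<^sub>E i\<in>{2..j+1}. carrier (path_algebra (A i))) \<and>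
     snd p 2 1 = \<alpha> 1 (fst p) \<and> (\<forall>i\<in>{3..j+1}. snd p i 1 = \<zero>\<^bsub>A i\<^esub>)"
proof -
  have "(\<forall>k\<in>{1..j}. snd p (k+1) 1 = iter_comp \<alpha> k (fst p)) \<longleftrightarrow>
      snd p 2 1 = \<alpha> 1 (fst p) \<and> (\<forall>i\<in>{3..j+1}. snd p i 1 = \<zero>\<^bsub>A i\<^esub>)"
    if a: "fst p \<in> carrier (A 1)"
  proof -
    have "{1..j} = insert 1 {2..j}" using assms by auto
    then have "(\<forall>k\<in>{1..j}. snd p (k+1) 1 = iter_comp \<alpha> k (fst p)) \<longleftrightarrow>
        snd p 2 1 = \<alpha> 1 (fst p) \<and> (\<forall>k\<in>{2..j}. snd p (k+1) 1 = \<zero>\<^bsub>A (k+1)\<^esub>)"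
      using iter_comp_eq_zero[OF _ _ a] assms by (auto simp: numeral_2_eq_2)
    also have "(\<forall>k\<in>{2..j}. snd p (k+1) 1 = \<zero>\<^bsub>A (k+1)\<^esub>) \<longleftrightarrow> (\<forall>i\<in>Suc ` {2..j}. snd p i 1 = \<zero>\<^bsub>A i\<^esub>)"
      by (simp del: image_Suc_atLeastAtMost)
    also have "Suc ` {2..j} = {3..j+1}"
      by (simp add: image_Suc_atLeastAtMost)
    finally show ?thesis .
  qed
  then show ?thesis
    by (auto simp: telescope_eq cstar_Sum_def mem_Times_iff)
qed

lemma cstar_hom_telescope_restrict:
  assumes "j \<le> n" "cstar_hom (ambient j) B h"
  shows "cstar_hom (telescope A \<alpha> j) B h"
  using cstar_hom_restrict_domain[OF assms(2)] cstar_algebra_telescope[OF assms(1)]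
  by (simp add: telescope_eq)

lemma cstar_hom_telescope_cone:
  assumes "1 \<le> j" "j \<le> n" "i \<in> {3..j+1}"
  shows "cstar_hom (telescope A \<alpha> j) (cstar_cone (A i)) (\<lambda>p. reverse (snd p i))"
  unfolding cstar_cone_def
proof (rule cstar_hom_restrict_codomain)
  show "cstar_hom (telescope A \<alpha> j) (path_algebra (A i)) (\<lambda>p. reverse (snd p i))"
    using assms
    by (intro cstar_hom_telescope_restrict cstar_hom_compose[OF cstar_hom_ambient_path cstar_hom_reverse]
      algebra) auto
  show "cstar_algebra (path_algebra (A i)\<lparr>carrier := {f \<in> carrier (path_algebra (A i)). f 0 = \<zero>\<^bsub>A i\<^esub>}\<rparr>)"
    using cstar_algebra_cone[OF algebra[of i]] assms by (simp add: cstar_cone_def)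
  show "reverse (snd p i) \<in> {f \<in> carrier (path_algebra (A i)). f 0 = \<zero>\<^bsub>A i\<^esub>}"
    if "p \<in> carrier (telescope A \<alpha> j)" for p
    using that assms by (auto simp: carrier_telescope intro!: reverse_in_path_algebra)
qed

text \<open>Split off the last path and reverse it.\<close>

theorem telescope_Suc_isomorphic:
  assumes "1 \<le> m" "m < n"
  shows "telescope A \<alpha> (Suc m) \<simeq>\<^sub>C telescope A \<alpha> m \<oplus>\<^sub>C cstar_cone (A (m+2))"
proof (rule cstar_isomorphicI)
  let ?T = "telescope A \<alpha>"
  let ?h = "\<lambda>p. ((fst p, \<lambda>i\<in>{2..m+1}. snd p i), reverse (snd p (m+2)))"
  let ?g = "\<lambda>q. (fst (fst q), \<lambda>i\<in>{2..m+2}. if i = m+2 then reverse (snd q) else snd (fst q) i)"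
  have to_ambient: "cstar_hom (?T (Suc m)) (ambient m) (\<lambda>p. (fst p, \<lambda>i\<in>{2..m+1}. snd p i))"
    using assms
    by (intro cstar_hom_pair cstar_hom_tuple cstar_algebra_telescope cstar_hom_telescope_restrict
      cstar_hom_ambient_base cstar_hom_ambient_path) auto
  have "cstar_hom (?T (Suc m)) (?T m) (\<lambda>p. (fst p, \<lambda>i\<in>{2..m+1}. snd p i))"
    unfolding telescope_eq[of m]
  proof (rule cstar_hom_restrict_codomain[OF to_ambient])
    show "cstar_algebra (ambient m\<lparr>carrier :=
        {p \<in> carrier (ambient m). \<forall>k\<in>{1..m}. snd p (k+1) 1 = iter_comp \<alpha> k (fst p)}\<rparr>)"
      using cstar_algebra_telescope[of m] assms by (simp add: telescope_eq)
    fix p assume p: "p \<in> carrier (?T (Suc m))"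
    then show "(fst p, \<lambda>i\<in>{2..m+1}. snd p i)
        \<in> {p \<in> carrier (ambient m). \<forall>k\<in>{1..m}. snd p (k+1) 1 = iter_comp \<alpha> k (fst p)}"
      using cstar_hom.hom_closed[OF to_ambient p] by (auto simp: telescope_eq)
  qed
  then show "cstar_hom (?T (Suc m)) (?T m \<oplus>\<^sub>C cstar_cone (A (m+2))) ?h"
    using assms by (intro cstar_hom_pair cstar_hom_telescope_cone) auto
  show "?g (?h p) = p" if "p \<in> carrier (?T (Suc m))" for p
  proof -
    have f: "snd p \<in> (\<Pi>\<^sub>E i\<in>{2..m+2}. carrier (path_algebra (A i)))"
      using that assms by (simp add: carrier_telescope)
    then have "snd p (m+2) \<in> extensional {0..1}"
      by (auto simp: carrier_path_algebra PiE_iff)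
    then have "snd (?g (?h p)) = snd p"
      using f by (intro extensionalityI[of _ "{2..m+2}"]) (auto simp: reverse_reverse PiE_iff)
    then show ?thesis by (simp add: prod_eq_iff)
  qed
  fix q assume q: "q \<in> carrier (?T m \<oplus>\<^sub>C cstar_cone (A (m+2)))"
  then have f: "snd (fst q) \<in> (\<Pi>\<^sub>E i\<in>{2..m+1}. carrier (path_algebra (A i)))"
    "fst (fst q) \<in> carrier (A 1)" "snd (fst q) 2 1 = \<alpha> 1 (fst (fst q))"
    "\<And>i. i \<in> {3..m+1} \<Longrightarrow> snd (fst q) i 1 = \<zero>\<^bsub>A i\<^esub>"
    and g: "snd q \<in> carrier (path_algebra (A (m+2)))" "snd q 0 = \<zero>\<^bsub>A (m+2)\<^esub>"
    using assms by (auto simp: carrier_telescope carrier_cstar_cone mem_Times_iff)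
  then show "?g q \<in> carrier (?T (Suc m))"
    using assms reverse_in_path_algebra[OF g(1)] by (auto simp: carrier_telescope PiE_iff)
  have "(\<lambda>i\<in>{2..m+1}. snd (?g q) i) = snd (fst q)"
    using f(1) by (intro extensionalityI[of _ "{2..m+1}"]) (auto simp: PiE_iff)
  moreover have "reverse (snd (?g q) (m+2)) = snd q"
    using g(1) by (simp add: reverse_reverse carrier_path_algebra)
  ultimately show "?h (?g q) = q"
    by (simp add: prod_eq_iff)
qed

text \<open>Keep the base point and the first path, which form the mapping cylinder, and reverse all other paths.\<close>

theorem telescope_isomorphic_Cyl_cones:
  assumes "2 \<le> n"
  shows "telescope A \<alpha> n \<simeq>\<^sub>C Cyl (A 1) (A 2) (\<alpha> 1) \<oplus>\<^sub>C cstar_Sum {3..n+1} (\<lambda>i. cstar_cone (A i))"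
proof (rule cstar_isomorphicI)
  let ?T = "telescope A \<alpha> n"
  let ?h = "\<lambda>p. ((fst p, snd p 2), \<lambda>i\<in>{3..n+1}. reverse (snd p i))"
  let ?g = "\<lambda>q. (fst (fst q), \<lambda>i\<in>{2..n+1}. if i = 2 then snd (fst q) else reverse (snd q i))"
  have hom1: "cstar_hom (A 1) (A 2) (\<alpha> 1)" using hom[of 1] assms by (simp add: numeral_2_eq_2)
  have to_sum: "cstar_hom ?T (A 1 \<oplus>\<^sub>C path_algebra (A 2)) (\<lambda>p. (fst p, snd p 2))"
    using assms
    by (intro cstar_hom_pair cstar_hom_telescope_restrict cstar_hom_ambient_base
      cstar_hom_ambient_path) auto
  have "cstar_hom ?T (Cyl (A 1) (A 2) (\<alpha> 1)) (\<lambda>p. (fst p, snd p 2))"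
    unfolding Cyl_eq
  proof (rule cstar_hom_restrict_codomain[OF to_sum])
    show "cstar_algebra ((A 1 \<oplus>\<^sub>C path_algebra (A 2))\<lparr>carrier :=
        {p \<in> carrier (A 1 \<oplus>\<^sub>C path_algebra (A 2)). snd p 1 = \<alpha> 1 (fst p)}\<rparr>)"
      using cstar_algebra_Cyl[OF hom1] by (simp add: Cyl_eq)
    show "(fst p, snd p 2) \<in> {p \<in> carrier (A 1 \<oplus>\<^sub>C path_algebra (A 2)). snd p 1 = \<alpha> 1 (fst p)}"
      if "p \<in> carrier ?T" for p
      using that assms by (auto simp: carrier_telescope)
  qed
  moreover have "cstar_hom ?T (cstar_Sum {3..n+1} (\<lambda>i. cstar_cone (A i))) (\<lambda>p. \<lambda>i\<in>{3..n+1}. reverse (snd p i))"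
    using assms by (intro cstar_hom_tuple cstar_hom_telescope_cone cstar_algebra_telescope) auto
  ultimately show "cstar_hom ?T (Cyl (A 1) (A 2) (\<alpha> 1) \<oplus>\<^sub>C cstar_Sum {3..n+1} (\<lambda>i. cstar_cone (A i))) ?h"
    by (rule cstar_hom_pair)
  show "?g (?h p) = p" if "p \<in> carrier ?T" for p
  proof -
    have f: "snd p \<in> (\<Pi>\<^sub>E i\<in>{2..n+1}. carrier (path_algebra (A i)))"
      using that assms by (simp add: carrier_telescope)
    then have "snd p i \<in> extensional {0..1}" if "i \<in> {2..n+1}" for i
      using that by (auto simp: carrier_path_algebra PiE_iff)
    then have "snd (?g (?h p)) = snd p"
      using f by (intro extensionalityI[of _ "{2..n+1}"]) (auto simp: reverse_reverse PiE_iff)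
    then show ?thesis by (simp add: prod_eq_iff)
  qed
  fix q assume q: "q \<in> carrier (Cyl (A 1) (A 2) (\<alpha> 1) \<oplus>\<^sub>C cstar_Sum {3..n+1} (\<lambda>i. cstar_cone (A i)))"
  then have f: "fst (fst q) \<in> carrier (A 1)" "snd (fst q) \<in> carrier (path_algebra (A 2))"
    "snd (fst q) 1 = \<alpha> 1 (fst (fst q))"
    and g: "snd q \<in> extensional {3..n+1}"
    "\<And>i. i \<in> {3..n+1} \<Longrightarrow> snd q i \<in> carrier (path_algebra (A i))"
    "\<And>i. i \<in> {3..n+1} \<Longrightarrow> snd q i 0 = \<zero>\<^bsub>A i\<^esub>"
    by (auto simp: Cyl_eq carrier_cstar_cone mem_Times_iff cstar_Sum_def PiE_iff)
  show "?g q \<in> carrier ?T"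
    using assms f g reverse_in_path_algebra[OF g(2)] by (auto simp: carrier_telescope PiE_iff)
  have "(\<lambda>i\<in>{3..n+1}. reverse (snd (?g q) i)) = snd q"
    using g(1,2) by (intro extensionalityI[of _ "{3..n+1}"])
      (auto simp: reverse_reverse carrier_path_algebra)
  moreover have "snd (?g q) 2 = snd (fst q)"
    using assms by simp
  ultimately show "?h (?g q) = q"
    by (simp add: prod_eq_iff)
qed

end

theorem corollary5p6:
  fixes A :: "nat \<Rightarrow> 'a cstar" and \<alpha> :: "nat \<Rightarrow> 'a \<Rightarrow> 'a" and n :: nat
  assumes "n \<ge> 2"
    and "\<And>i. i \<in> {1..n+1} \<Longrightarrow> cstar_algebra (A i)"
    and "\<And>k. k \<in> {1..n} \<Longrightarrow> cstar_hom (A k) (A (k+1)) (\<alpha> k)"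
    and exact: "\<And>k. k \<in> {1..n-1} \<Longrightarrow>
      a_kernel (A (k+1)) (A (k+2)) (\<alpha> (k+1)) = \<alpha> k ` carrier (A k)"
  shows "telescope A \<alpha> n \<simeq>\<^sub>C telescope A \<alpha> (n-1) \<oplus>\<^sub>C cstar_cone (A (n+1)) \<and>
    telescope A \<alpha> n \<simeq>\<^sub>C
      Cyl (A 1) (A 2) (\<alpha> 1) \<oplus>\<^sub>C cstar_Sum {3..n+1} (\<lambda>i. cstar_cone (A i))"
proof -
  interpret cstar_exact_sequence A \<alpha> n
    by (rule cstar_exact_sequence.intro) (fact assms)+
  obtain m where "n = Suc m" "1 \<le> m"
    using assms(1) by (cases n) auto
  then show ?thesis
    using telescope_Suc_isomorphic[of m] telescope_isomorphic_Cyl_cones assms(1) by simp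
qed

end
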